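(* Let $M$ be a Dynkin diagram of type $\mathrm{A}_n$, $\mathrm{B}_n$, $\mathrm{C}_n$, $\mathrm{D}_n$, $\mathrm{E}_6$, $\mathrm{E}_7$, $\mathrm{E}_8$ or $\mathrm{F}_4$. There is an algebra homomorphism $\phi:\mathrm{DTL}(M)\to \mathrm{Br}(M)$ mapping each generator $e_i$ of $\mathrm{DTL}(M)$ to the generator $e_i$ of $\mathrm{Br}(M)$. Furthermore, for $(M,Q)$ one of $(\mathrm{C}_n,\mathrm{A}_{2n-1})$, $(\mathrm{B}_n,\mathrm{D}_{n+1})$ (with $n\ge2$), $(\mathrm{F}_4,\mathrm{E}_6)$, the folding assignments on generators given in the context define algebra homomorphisms $\mathrm{Br}(M)\to\mathrm{Br}(Q)$ and $\mathrm{DTL}(M)\to \mathrm{TL}(Q)$, and the square formed by $\mathrm{DTL}(M)\xrightarrow{\phi}\mathrm{Br}(M)\to\mathrm{Br}(Q)$ and $\mathrm{DTL}(M)\to\mathrm{TL}(Q)\to\mathrm{Br}(Q)$ commutes, where $\mathrm{TL}(Q)\to\mathrm{Br}(Q)$ is the homomorphism sending $E_j$ to $E_j$.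
   Context: All algebras are associative and unital over $\mathbb{Z}[\delta^{\pm 1}]$, $\delta$ an invertible indeterminate. Diagrams. Write $i - j$ for a single bond and $i\Rightarrow j$ for a double bond with its arrow pointing from $i$ to $j$. $\mathrm{A}_n$: nodes $1,\dots,n$, bonds $i-(i+1)$. $\mathrm{D}_n$: nodes $1,\dots,n$, bonds $1-3$, $2-3$, and $i-(i+1)$ for $3\le i\le n-1$. $\mathrm{E}_n$ ($n=6,7,8$): nodes $1,\dots,n$, bonds $1-3$, $3-4$, $2-4$, and $i-(i+1)$ for $4\le i\le n-1$. $\mathrm{B}_n$: nodes $0,\dots,n-1$, bonds $i-(i+1)$ for $1\le i\le n-2$, and $1\Rightarrow 0$. $\mathrm{C}_n$: nodes $0,\dots,n-1$, bonds $i-(i+1)$ for $1\le i\le n-2$, and $0\Rightarrow 1$. $\mathrm{F}_4$: nodes $1,2,3,4$, bonds $1-2$, $3-4$, and $3\Rightarrow 2$. Parameters $\kappa_i$: $\kappa_i=1$ for all $i$ in types A, D, E; in type $\mathrm{C}_n$, $\kappa_0=1$ and $\kappa_i=2$ for $i\ge1$; in type $\mathrm{B}_n$, $\kappa_0=2$ and $\kappa_i=1$ for $i\ge1$; in type $\mathrm{F}_4$, $\kappa_1=\kappa_2=2$, $\kappa_3=\kappa_4=1$. $\mathrm{DTL}(M)$ is generated by $\{e_i\}_{i\in M}$ with relations: $e_i^2=\delta^{\kappa_i}e_i$; $e_ie_j=e_je_i$ if $i,j$ are distinct and not adjacent; $e_ie_je_i=e_i$ if $i-j$; $e_je_ie_j=\delta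 e_j$ if $i\Rightarrow j$. For $Q$ simply laced, $\mathrm{TL}(Q)$ denotes $\mathrm{DTL}(Q)$, with generators written $E_j$. $\mathrm{Br}(M)$ is generated by $\{r_i,e_i\}_{i\in M}$ with relations: for each $i$: $r_i^2=1$, $r_ie_i=e_ir_i=e_i$, $e_i^2=\delta^{\kappa_i}e_i$; for $i,j$ distinct and non-adjacent: $r_ir_j=r_jr_i$, $e_ir_j=r_je_i$, $e_ie_j=e_je_i$; for $i-j$: $r_ir_jr_i=r_jr_ir_j$, $r_jr_ie_j=e_ie_j$, $r_ie_jr_i=r_je_ir_j$; for $i\Rightarrow j$: $r_jr_ir_jr_i=r_ir_jr_ir_j$, $r_jr_ie_j=r_ie_j$, $r_je_ir_je_i=e_ie_je_i$, $(r_jr_ir_j)e_i=e_i(r_jr_ir_j)$, $e_jr_ie_j=\delta e_j$, $e_je_ie_j=\delta e_j$, $e_jr_ir_j=e_jr_i$, $e_je_ir_j=e_je_i$. For simply laced $Q$, the generators of $\mathrm{Br}(Q)$ are written $R_j,E_j$ in place of $r_j,e_j$. Folding assignments (the $\mathrm{DTL}(M)\to\mathrm{TL}(Q)$ assignment is the one on the $e_i$ only): $(\mathrm{C}_n,\mathrm{A}_{2n-1})$: $r_0\mapsto R_n$, $e_0\mapsto E_n$, $r_i\mapsto R_{n-i}R_{n+i}$, $e_i\mapsto E_{n-i}E_{n+i}$ for $1\le i\le n-1$. $(\mathrm{B}_n,\mathrm{D}_{n+1})$: $r_0\mapsto R_1R_2$, $e_0\mapsto E_1E_2$, $r_i\mapsto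 R_{i+2}$, $e_i\mapsto E_{i+2}$ for $1\le i\le n-1$. $(\mathrm{F}_4,\mathrm{E}_6)$: $r_1\mapsto R_1R_6$, $r_2\mapsto R_3R_5$, $r_3\mapsto R_4$, $r_4\mapsto R_2$, and likewise $e_1\mapsto E_1E_6$, $e_2\mapsto E_3E_5$, $e_3\mapsto E_4$, $e_4\mapsto E_2$. *)

theory Defs
  imports "HOL-Algebra.QuotRing" "HOL-Algebra.Module" "HOL-Library.Poly_Mapping"
begin

section \<open>Free algebras and presentations over the Laurent polynomial ring\<close>

text \<open>
  Convolution of finitely supported functions on the additive group of integers is the
  multiplication of Laurent polynomials, so \<open>int \<Rightarrow>\<^sub>0 int\<close> is the ring of integral Laurent
  polynomials in one indeterminate, here \<open>\<delta>\<close>.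
\<close>

type_synonym laurent = "int \<Rightarrow>\<^sub>0 int"

definition delta :: laurent where
  "delta = Poly_Mapping.single 1 1"

text \<open>
  The free monoid is written additively, because the convolution product on \<open>'a \<Rightarrow>\<^sub>0 'b\<close> is
  available for (not necessarily commutative) additive monoids \<open>'a\<close>.
\<close>

datatype 'g fmon = Fmon (letters: "'g list")

instantiation fmon :: (type) monoid_add
begin

definition zero_fmon :: "'g fmon" where
  "zero_fmon = Fmon []"

definition plus_fmon :: "'g fmon \<Rightarrow> 'g fmon \<Rightarrow> 'g fmon" where
  "plus_fmon v w = Fmon (letters v @ letters w)"

instance
  by standard (simp_all add: zero_fmon_def plus_fmon_def)

end

type_synonym 'g falg = "'g fmon \<Rightarrow>\<^sub>0 laurent"

definition gen :: "'g \<Rightarrow> 'g falg" where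
  "gen x = Poly_Mapping.single (Fmon [x]) 1"

definition scalar :: "laurent \<Rightarrow> 'g falg" where
  "scalar c = Poly_Mapping.single 0 c"

definition free_algebra :: "'g set \<Rightarrow> (laurent, 'g falg) module" where
  "free_algebra S =
    \<lparr>carrier = {p. \<forall>w\<in>Poly_Mapping.keys p. set (letters w) \<subseteq> S},
     mult = (*), one = 1, zero = 0, add = (+),
     smult = (\<lambda>c p. scalar c * p)\<rparr>"

text \<open>
  A pair \<open>(a, b)\<close> in \<open>Rel\<close> stands for the relation \<open>a = b\<close>. The ring part of the presented
  algebra is the quotient of the free algebra by the two-sided ideal generated by all
  differences \<open>a - b\<close>; HOL-Algebra ideals are two-sided.
\<close>

definition relation_ideal :: "'g set \<Rightarrow> ('g falg \<times> 'g falg) set \<Rightarrow> 'g falg set" where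
  "relation_ideal S Rel = genideal (free_algebra S) {a - b | a b. (a, b) \<in> Rel}"

definition presented_algebra ::
    "'g set \<Rightarrow> ('g falg \<times> 'g falg) set \<Rightarrow> (laurent, 'g falg set) module" where
  "presented_algebra S Rel =
    ring.extend (free_algebra S Quot relation_ideal S Rel)
      (module.fields
        (\<lambda>c C. \<Union>p\<in>C. relation_ideal S Rel +>\<^bsub>free_algebra S\<^esub> (c \<odot>\<^bsub>free_algebra S\<^esub> p)))"

definition presented_gen ::
    "'g set \<Rightarrow> ('g falg \<times> 'g falg) set \<Rightarrow> 'g \<Rightarrow> 'g falg set" where
  "presented_gen S Rel x = relation_ideal S Rel +>\<^bsub>free_algebra S\<^esub> gen x"

definition alg_hom :: "('c, 'a) module \<Rightarrow> ('c, 'b) module \<Rightarrow> ('a \<Rightarrow> 'b) set" where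
  "alg_hom A B =
    {h \<in> ring_hom A B. \<forall>c. \<forall>x\<in>carrier A. h (c \<odot>\<^bsub>A\<^esub> x) = c \<odot>\<^bsub>B\<^esub> h x}"


section \<open>Dynkin diagrams\<close>

text \<open>
  A pair in \<open>simple_bonds\<close> is an unordered bond, listed in one of its two orders only;
  \<open>(i, j)\<close> in \<open>double_bonds\<close> is a double bond with its arrow pointing from \<open>i\<close> to \<open>j\<close>.
\<close>

record diagram =
  nodes :: "nat set"
  simple_bonds :: "(nat \<times> nat) set"
  double_bonds :: "(nat \<times> nat) set"
  kappa :: "nat \<Rightarrow> nat"

definition simply_bonded :: "diagram \<Rightarrow> nat \<Rightarrow> nat \<Rightarrow> bool" where
  "simply_bonded M i j \<longleftrightarrow> i \<in> nodes M \<and> j \<in> nodes M \<and>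
     ((i, j) \<in> simple_bonds M \<or> (j, i) \<in> simple_bonds M)"

definition doubly_bonded :: "diagram \<Rightarrow> nat \<Rightarrow> nat \<Rightarrow> bool" where
  "doubly_bonded M i j \<longleftrightarrow> i \<in> nodes M \<and> j \<in> nodes M \<and> (i, j) \<in> double_bonds M"

definition non_adjacent :: "diagram \<Rightarrow> nat \<Rightarrow> nat \<Rightarrow> bool" where
  "non_adjacent M i j \<longleftrightarrow> i \<in> nodes M \<and> j \<in> nodes M \<and> i \<noteq> j \<and>
     \<not> simply_bonded M i j \<and> \<not> doubly_bonded M i j \<and> \<not> doubly_bonded M j i"

definition dynkin_A :: "nat \<Rightarrow> diagram" where
  "dynkin_A n =
    \<lparr>nodes = {1..n},
     simple_bonds = {(i, i + 1) | i. 1 \<le> i \<and> i + 1 \<le> n},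
     double_bonds = {},
     kappa = (\<lambda>i. 1)\<rparr>"

definition dynkin_B :: "nat \<Rightarrow> diagram" where
  "dynkin_B n =
    \<lparr>nodes = {0..<n},
     simple_bonds = {(i, i + 1) | i. 1 \<le> i \<and> i + 2 \<le> n},
     double_bonds = {(1, 0)},
     kappa = (\<lambda>i. if i = 0 then 2 else 1)\<rparr>"

text \<open>
  Only bonds between nodes count, so \<open>dynkin_C 1\<close> is a single node without bonds.
\<close>

definition dynkin_C :: "nat \<Rightarrow> diagram" where
  "dynkin_C n =
    \<lparr>nodes = {0..<n},
     simple_bonds = {(i, i + 1) | i. 1 \<le> i \<and> i + 2 \<le> n},
     double_bonds = {(0, 1)},
     kappa = (\<lambda>i. if i = 0 then 1 else 2)\<rparr>"

definition dynkin_D :: "nat \<Rightarrow> diagram" where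
  "dynkin_D n =
    \<lparr>nodes = {1..n},
     simple_bonds = {(1, 3), (2, 3)} \<union> {(i, i + 1) | i. 3 \<le> i \<and> i + 1 \<le> n},
     double_bonds = {},
     kappa = (\<lambda>i. 1)\<rparr>"

definition dynkin_E :: "nat \<Rightarrow> diagram" where
  "dynkin_E n =
    \<lparr>nodes = {1..n},
     simple_bonds = {(1, 3), (3, 4), (2, 4)} \<union> {(i, i + 1) | i. 4 \<le> i \<and> i + 1 \<le> n},
     double_bonds = {},
     kappa = (\<lambda>i. 1)\<rparr>"

definition dynkin_F4 :: diagram where
  "dynkin_F4 =
    \<lparr>nodes = {1, 2, 3, 4},
     simple_bonds = {(1, 2), (3, 4)},
     double_bonds = {(3, 2)},
     kappa = (\<lambda>i. if i \<le> 2 then 2 else 1)\<rparr>"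

text \<open>
  Type \<open>D\<^sub>3\<close> is included because it is the target of the folding of \<open>B\<^sub>2\<close>.
\<close>

inductive dynkin :: "diagram \<Rightarrow> bool" where
  "1 \<le> n \<Longrightarrow> dynkin (dynkin_A n)"
| "2 \<le> n \<Longrightarrow> dynkin (dynkin_B n)"
| "1 \<le> n \<Longrightarrow> dynkin (dynkin_C n)"
| "3 \<le> n \<Longrightarrow> dynkin (dynkin_D n)"
| "n \<in> {6, 7, 8} \<Longrightarrow> dynkin (dynkin_E n)"
| "dynkin dynkin_F4"


section \<open>Temperley-Lieb and Brauer algebras of a diagram\<close>

text \<open>
  The free generator \<open>gen i\<close> is the Temperley-Lieb generator \<open>e\<^sub>i\<close>.
\<close>

inductive_set dtl_rels :: "diagram \<Rightarrow> (nat falg \<times> nat falg) set" for M :: diagram where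
  "i \<in> nodes M \<Longrightarrow> (gen i * gen i, scalar (delta ^ kappa M i) * gen i) \<in> dtl_rels M"
| "non_adjacent M i j \<Longrightarrow> (gen i * gen j, gen j * gen i) \<in> dtl_rels M"
| "simply_bonded M i j \<Longrightarrow> (gen i * gen j * gen i, gen i) \<in> dtl_rels M"
| "doubly_bonded M i j \<Longrightarrow> (gen j * gen i * gen j, scalar delta * gen j) \<in> dtl_rels M"

definition DTL :: "diagram \<Rightarrow> (laurent, nat falg set) module" where
  "DTL M = presented_algebra (nodes M) (dtl_rels M)"

definition dtl_e :: "diagram \<Rightarrow> nat \<Rightarrow> nat falg set" where
  "dtl_e M i = presented_gen (nodes M) (dtl_rels M) i"

text \<open>
  For simply laced \<open>Q\<close> the Temperley-Lieb algebra \<open>TL Q\<close> is by convention \<open>DTL Q\<close>.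
\<close>

abbreviation (input) TL :: "diagram \<Rightarrow> (laurent, nat falg set) module" where
  "TL Q \<equiv> DTL Q"

datatype brauer_gen = RGen nat | EGen nat

abbreviation r :: "nat \<Rightarrow> brauer_gen falg" where
  "r i \<equiv> gen (RGen i)"

abbreviation e :: "nat \<Rightarrow> brauer_gen falg" where
  "e i \<equiv> gen (EGen i)"

inductive_set br_rels :: "diagram \<Rightarrow> (brauer_gen falg \<times> brauer_gen falg) set"
  for M :: diagram where
  "i \<in> nodes M \<Longrightarrow> (r i * r i, 1) \<in> br_rels M"
| "i \<in> nodes M \<Longrightarrow> (r i * e i, e i) \<in> br_rels M"
| "i \<in> nodes M \<Longrightarrow> (e i * r i, e i) \<in> br_rels M"
| "i \<in> nodes M \<Longrightarrow> (e i * e i, scalar (delta ^ kappa M i) * e i) \<in> br_rels M"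
| "non_adjacent M i j \<Longrightarrow> (r i * r j, r j * r i) \<in> br_rels M"
| "non_adjacent M i j \<Longrightarrow> (e i * r j, r j * e i) \<in> br_rels M"
| "non_adjacent M i j \<Longrightarrow> (e i * e j, e j * e i) \<in> br_rels M"
| "simply_bonded M i j \<Longrightarrow> (r i * r j * r i, r j * r i * r j) \<in> br_rels M"
| "simply_bonded M i j \<Longrightarrow> (r j * r i * e j, e i * e j) \<in> br_rels M"
| "simply_bonded M i j \<Longrightarrow> (r i * e j * r i, r j * e i * r j) \<in> br_rels M"
| "doubly_bonded M i j \<Longrightarrow> (r j * r i * r j * r i, r i * r j * r i * r j) \<in> br_rels M"
| "doubly_bonded M i j \<Longrightarrow> (r j * r i * e j, r i * e j) \<in> br_rels M"
| "doubly_bonded M i j \<Longrightarrow> (r j * e i * r j * e i, e i * e j * e i) \<in> br_rels M"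
| "doubly_bonded M i j \<Longrightarrow> ((r j * r i * r j) * e i, e i * (r j * r i * r j)) \<in> br_rels M"
| "doubly_bonded M i j \<Longrightarrow> (e j * r i * e j, scalar delta * e j) \<in> br_rels M"
| "doubly_bonded M i j \<Longrightarrow> (e j * e i * e j, scalar delta * e j) \<in> br_rels M"
| "doubly_bonded M i j \<Longrightarrow> (e j * r i * r j, e j * r i) \<in> br_rels M"
| "doubly_bonded M i j \<Longrightarrow> (e j * e i * r j, e j * e i) \<in> br_rels M"

definition br_gens :: "diagram \<Rightarrow> brauer_gen set" where
  "br_gens M = RGen ` nodes M \<union> EGen ` nodes M"

definition Br :: "diagram \<Rightarrow> (laurent, brauer_gen falg set) module" where
  "Br M = presented_algebra (br_gens M) (br_rels M)"

definition br_r :: "diagram \<Rightarrow> nat \<Rightarrow> brauer_gen falg set" where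
  "br_r M i = presented_gen (br_gens M) (br_rels M) (RGen i)"

definition br_e :: "diagram \<Rightarrow> nat \<Rightarrow> brauer_gen falg set" where
  "br_e M i = presented_gen (br_gens M) (br_rels M) (EGen i)"


section \<open>Folding\<close>

text \<open>
  In \<open>diagram_folding M Q \<sigma>\<close> the list \<open>\<sigma> i\<close> consists of the nodes of \<open>Q\<close> over the node \<open>i\<close> of \<open>M\<close>:
  the assignment is \<open>r\<^sub>i \<mapsto> R\<^sub>j\<^sub>1 \<cdots> R\<^sub>j\<^sub>k\<close> and \<open>e\<^sub>i \<mapsto> E\<^sub>j\<^sub>1 \<cdots> E\<^sub>j\<^sub>k\<close> for \<open>\<sigma> i = [j\<^sub>1, \<dots>, j\<^sub>k]\<close>.
\<close>

inductive diagram_folding :: "diagram \<Rightarrow> diagram \<Rightarrow> (nat \<Rightarrow> nat list) \<Rightarrow> bool" where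
  "1 \<le> n \<Longrightarrow> diagram_folding (dynkin_C n) (dynkin_A (2 * n - 1))
     (\<lambda>i. if i = 0 then [n] else [n - i, n + i])"
| "2 \<le> n \<Longrightarrow> diagram_folding (dynkin_B n) (dynkin_D (n + 1))
     (\<lambda>i. if i = 0 then [1, 2] else [i + 2])"
| "diagram_folding dynkin_F4 (dynkin_E 6)
     (\<lambda>i. if i = 1 then [1, 6] else if i = 2 then [3, 5] else if i = 3 then [4] else [2])"

definition alg_prod :: "('c, 'a) module \<Rightarrow> 'a list \<Rightarrow> 'a" where
  "alg_prod A xs = foldr (\<lambda>x y. x \<otimes>\<^bsub>A\<^esub> y) xs \<one>\<^bsub>A\<^esub>"

definition canonical_hom ::
    "diagram \<Rightarrow> (nat falg set \<Rightarrow> brauer_gen falg set) \<Rightarrow> bool" where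
  "canonical_hom M \<phi> \<longleftrightarrow>
     \<phi> \<in> alg_hom (DTL M) (Br M) \<and> (\<forall>i\<in>nodes M. \<phi> (dtl_e M i) = br_e M i)"

definition br_folding_hom ::
    "diagram \<Rightarrow> diagram \<Rightarrow> (nat \<Rightarrow> nat list) \<Rightarrow>
     (brauer_gen falg set \<Rightarrow> brauer_gen falg set) \<Rightarrow> bool" where
  "br_folding_hom M Q \<sigma> f \<longleftrightarrow>
     f \<in> alg_hom (Br M) (Br Q) \<and>
     (\<forall>i\<in>nodes M. f (br_r M i) = alg_prod (Br Q) (map (br_r Q) (\<sigma> i)) \<and>
                   f (br_e M i) = alg_prod (Br Q) (map (br_e Q) (\<sigma> i)))"

definition tl_folding_hom ::
    "diagram \<Rightarrow> diagram \<Rightarrow> (nat \<Rightarrow> nat list) \<Rightarrow>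
     (nat falg set \<Rightarrow> nat falg set) \<Rightarrow> bool" where
  "tl_folding_hom M Q \<sigma> g \<longleftrightarrow>
     g \<in> alg_hom (DTL M) (TL Q) \<and>
     (\<forall>i\<in>nodes M. g (dtl_e M i) = alg_prod (TL Q) (map (dtl_e Q) (\<sigma> i)))"

lemma folding_dynkin:
  assumes "diagram_folding M Q \<sigma>"
  shows "dynkin M" "dynkin Q"
  using assms by (auto elim!: diagram_folding.cases intro: dynkin.intros)

lemma folding_nodes:
  assumes "diagram_folding M Q \<sigma>" "i \<in> nodes M"
  shows "set (\<sigma> i) \<subseteq> nodes Q"
  using assms
  by (auto elim!: diagram_folding.cases
      simp: dynkin_A_def dynkin_B_def dynkin_C_def dynkin_D_def dynkin_E_def dynkin_F4_def
      split: if_splits)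


section \<open>The presented algebras are rings\<close>

lemma letters_add [simp]: "letters (v + w) = letters v @ letters w"
  by (simp add: plus_fmon_def)

lemma letters_zero [simp]: "letters 0 = []"
  by (simp add: zero_fmon_def)

lemma in_free_algebra:
  "p \<in> carrier (free_algebra S) \<longleftrightarrow> (\<forall>w\<in>Poly_Mapping.keys p. set (letters w) \<subseteq> S)"
  by (simp add: free_algebra_def)

lemma free_algebra_add_closed:
  "p \<in> carrier (free_algebra S) \<Longrightarrow> q \<in> carrier (free_algebra S) \<Longrightarrow>
    p + q \<in> carrier (free_algebra S)"
  unfolding in_free_algebra using keys_add[of p q] by blast

lemma free_algebra_minus_closed:
  "p \<in> carrier (free_algebra S) \<Longrightarrow> - p \<in> carrier (free_algebra S)"
  by (simp add: in_free_algebra)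

lemma free_algebra_mult_closed:
  assumes "p \<in> carrier (free_algebra S)" "q \<in> carrier (free_algebra S)"
  shows "p * q \<in> carrier (free_algebra S)"
  unfolding in_free_algebra
proof
  fix w assume "w \<in> Poly_Mapping.keys (p * q)"
  then obtain a b where "w = a + b" "a \<in> Poly_Mapping.keys p" "b \<in> Poly_Mapping.keys q"
    using keys_mult[of p q] by blast
  with assms show "set (letters w) \<subseteq> S"
    by (simp add: in_free_algebra)
qed

lemma free_algebra_one_closed: "1 \<in> carrier (free_algebra S)"
  by (simp add: in_free_algebra)

lemma free_algebra_gen_closed: "x \<in> S \<Longrightarrow> gen x \<in> carrier (free_algebra S)"
  by (simp add: in_free_algebra gen_def)

lemma free_algebra_scalar_closed: "scalar c \<in> carrier (free_algebra S)"
  by (simp add: in_free_algebra scalar_def)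

lemmas free_algebra_closed =
  free_algebra_add_closed free_algebra_minus_closed free_algebra_mult_closed
  free_algebra_one_closed free_algebra_gen_closed free_algebra_scalar_closed

lemma free_algebra_simps:
  "mult (free_algebra S) = (*)" "one (free_algebra S) = 1"
  "zero (free_algebra S) = 0" "add (free_algebra S) = (+)"
  "smult (free_algebra S) = (\<lambda>c p. scalar c * p)"
  by (simp_all add: free_algebra_def)

lemma ring_free_algebra: "ring (free_algebra S)"
proof (rule ringI)
  show "abelian_group (free_algebra S)"
  proof (rule abelian_groupI)
    fix p assume p: "p \<in> carrier (free_algebra S)"
    show "\<exists>q\<in>carrier (free_algebra S). q \<oplus>\<^bsub>free_algebra S\<^esub> p = \<zero>\<^bsub>free_algebra S\<^esub>"
      by (rule bexI[OF _ free_algebra_minus_closed[OF p]]) (simp add: free_algebra_simps)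
  next
    show "\<zero>\<^bsub>free_algebra S\<^esub> \<in> carrier (free_algebra S)"
      by (simp add: free_algebra_simps in_free_algebra)
  qed (simp_all add: free_algebra_simps free_algebra_add_closed add.assoc add.commute)
  show "Group.monoid (free_algebra S)"
    by (rule monoidI)
      (simp_all add: free_algebra_simps free_algebra_mult_closed free_algebra_one_closed mult.assoc)
qed (simp_all add: free_algebra_simps distrib_left distrib_right)

lemma ideal_relation_ideal:
  assumes "Rel \<subseteq> carrier (free_algebra S) \<times> carrier (free_algebra S)"
  shows "ideal (relation_ideal S Rel) (free_algebra S)"
  unfolding relation_ideal_def
proof (rule ring.genideal_ideal[OF ring_free_algebra], clarify)
  fix a b assume "(a, b) \<in> Rel"
  with assms have "a \<in> carrier (free_algebra S)" "- b \<in> carrier (free_algebra S)"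
    by (auto intro: free_algebra_minus_closed)
  from free_algebra_add_closed[OF this] show "a - b \<in> carrier (free_algebra S)"
    by simp
qed

lemma presented_algebra_simps:
  "carrier (presented_algebra S Rel) = carrier (free_algebra S Quot relation_ideal S Rel)"
  "mult (presented_algebra S Rel) = mult (free_algebra S Quot relation_ideal S Rel)"
  "one (presented_algebra S Rel) = one (free_algebra S Quot relation_ideal S Rel)"
  "zero (presented_algebra S Rel) = zero (free_algebra S Quot relation_ideal S Rel)"
  "add (presented_algebra S Rel) = add (free_algebra S Quot relation_ideal S Rel)"
  by (simp_all add: presented_algebra_def ring.defs module.defs)

lemma ring_presented_algebra:
  assumes "Rel \<subseteq> carrier (free_algebra S) \<times> carrier (free_algebra S)"
  shows "ring (presented_algebra S Rel)"
  using ideal.quotient_is_ring[OF ideal_relation_ideal[OF assms]]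
  unfolding ring_def abelian_group_def abelian_monoid_def abelian_group_axioms_def
    ring_axioms_def Group.monoid_def comm_monoid_def comm_monoid_axioms_def comm_group_def
    Group.group_def group_axioms_def Units_def partial_object.simps monoid.simps
    presented_algebra_simps .

lemma bonded_nodes:
  "simply_bonded M i j \<Longrightarrow> i \<in> nodes M \<and> j \<in> nodes M"
  "doubly_bonded M i j \<Longrightarrow> i \<in> nodes M \<and> j \<in> nodes M"
  "non_adjacent M i j \<Longrightarrow> i \<in> nodes M \<and> j \<in> nodes M"
  by (simp_all add: simply_bonded_def doubly_bonded_def non_adjacent_def)

lemma dtl_rels_closed:
  "dtl_rels M \<subseteq> carrier (free_algebra (nodes M)) \<times> carrier (free_algebra (nodes M))"
proof (intro subrelI SigmaI)
  fix a b assume "(a, b) \<in> dtl_rels M"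
  then show "a \<in> carrier (free_algebra (nodes M))" "b \<in> carrier (free_algebra (nodes M))"
    by (induction rule: dtl_rels.induct)
      (auto dest!: bonded_nodes intro!: free_algebra_closed)
qed

lemma br_rels_closed:
  "br_rels M \<subseteq> carrier (free_algebra (br_gens M)) \<times> carrier (free_algebra (br_gens M))"
proof (intro subrelI SigmaI)
  fix a b assume "(a, b) \<in> br_rels M"
  then show "a \<in> carrier (free_algebra (br_gens M))" "b \<in> carrier (free_algebra (br_gens M))"
    by (induction rule: br_rels.induct)
      (auto simp: br_gens_def dest!: bonded_nodes intro!: free_algebra_closed)
qed

lemma ring_DTL: "ring (DTL M)"
  unfolding DTL_def by (rule ring_presented_algebra[OF dtl_rels_closed])

lemma ring_Br: "ring (Br M)"
  unfolding Br_def by (rule ring_presented_algebra[OF br_rels_closed])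

end

theory Submission
  imports Defs
begin

text \<open>
  Since substitution of words into the free algebra respects relation ideals as soon as it respects
  the defining relations, every homomorphism reduces to a check of relations in \<open>Br Q\<close> or \<open>TL Q\<close>,
  and the square commutes because it does so on the generators \<open>e\<^sub>i\<close>.

  The only relation of \<open>DTL M\<close> missing from the presentation of \<open>Br M\<close> is \<open>e\<^sub>ie\<^sub>je\<^sub>i = e\<^sub>i\<close> for a single
  bond; it follows from \<open>r\<^sub>jr\<^sub>ie\<^sub>j = e\<^sub>ie\<^sub>j\<close> by \<open>e\<^sub>ie\<^sub>je\<^sub>i = r\<^sub>jr\<^sub>ie\<^sub>je\<^sub>i = r\<^sub>jr\<^sub>ir\<^sub>ir\<^sub>je\<^sub>i = e\<^sub>i\<close>.

  The fibres of a folding consist of one node, or of two non-adjacent nodes. A single bond of \<open>M\<close>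
  lifts to one bond or to two bonds that commute with each other, so that words over it factor into
  two independent words. A double bond \<open>i \<Rightarrow> j\<close> lifts to a path \<open>a - b - c\<close> with \<open>b\<close> over \<open>i\<close> and
  \<open>a\<close>, \<open>c\<close> over \<open>j\<close>, so that all double bond relations are identities in the Brauer algebra of type
  \<open>A\<^sub>3\<close>.
\<close>


section \<open>Substitution homomorphisms of free algebras\<close>

lemma scalar_0 [simp]: "scalar 0 = 0"
  by (simp add: scalar_def)

lemma scalar_1 [simp]: "scalar 1 = 1"
  by (simp add: scalar_def)

lemma scalar_add: "scalar (a + b) = scalar a + scalar b"
  by (simp add: scalar_def single_add)

lemma scalar_mult: "scalar (a * b) = scalar a * scalar b"
  by (simp add: scalar_def mult_single)

text \<open>Scalars sit at the empty word, which is neutral on both sides, and coefficients commute.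
  So centrality holds for monomials and extends additively.\<close>

lemma scalar_commute: "p * scalar c = scalar c * p"
  unfolding scalar_def
proof (induction p rule: update_induct)
  case (update f a b)
  \<comment> \<open>\<open>a\<close> is not yet a key of \<open>f\<close>, so the update adds a
    monomial.\<close>
  have "Poly_Mapping.update a b f = f + Poly_Mapping.single a b"
    using update.hyps
    by (intro poly_mapping_eqI)
       (auto simp: lookup_update lookup_add lookup_single when_def in_keys_iff)
  with update.IH show ?case
    by (simp add: algebra_simps mult_single)
qed simp

lemma single_conv_prod_list:
  "Poly_Mapping.single w c = scalar c * prod_list (map gen (letters w))"
proof -
  have "prod_list (map gen xs) = Poly_Mapping.single (Fmon xs) 1" for xs :: "'a list"
    by (induction xs)
       (simp_all add: gen_def mult_single zero_fmon_def plus_fmon_def flip: single_one)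
  then show ?thesis
    by (simp add: scalar_def mult_single plus_fmon_def)
qed

lemma free_algebra_prod_list_closed:
  "set ps \<subseteq> carrier (free_algebra S) \<Longrightarrow> prod_list ps \<in> carrier (free_algebra S)"
  by (induction ps) (auto intro: free_algebra_closed)

lemma free_algebra_zero_closed: "0 \<in> carrier (free_algebra S)"
  by (simp add: in_free_algebra)

lemma sum_monomials:
  "(\<Sum>w\<in>Poly_Mapping.keys p. Poly_Mapping.single w (Poly_Mapping.lookup p w)) = p"
  by (rule poly_mapping_eqI)
     (simp add: lookup_sum lookup_single when_def in_keys_iff)

text \<open>Elements of the carrier are finite sums of monomials, and each monomial is a scalar
  times a product of letters from \<open>S\<close>.\<close>

lemma free_algebra_induct [consumes 1, case_names zero add scalar one gen]:
  assumes p: "p \<in> carrier (free_algebra S)"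
    and zero: "P 0"
    and add: "\<And>p q. p \<in> carrier (free_algebra S) \<Longrightarrow> q \<in> carrier (free_algebra S) \<Longrightarrow>
           P p \<Longrightarrow> P q \<Longrightarrow> P (p + q)"
    and scalar: "\<And>c p. p \<in> carrier (free_algebra S) \<Longrightarrow> P p \<Longrightarrow> P (scalar c * p)"
    and one: "P 1"
    and gen: "\<And>x p. x \<in> S \<Longrightarrow> p \<in> carrier (free_algebra S) \<Longrightarrow> P p \<Longrightarrow> P (gen x * p)"
  shows "P p"
proof -
  let ?F = "carrier (free_algebra S)"
  have word: "prod_list (map gen xs) \<in> ?F \<and> P (prod_list (map gen xs))" if "set xs \<subseteq> S" for xs
    using that by (induction xs) (auto intro: one gen free_algebra_closed)
  have mono: "Poly_Mapping.single w c \<in> ?F \<and> P (Poly_Mapping.single w c)"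
    if "set (letters w) \<subseteq> S" for w c
    using word[OF that] unfolding single_conv_prod_list
    by (auto intro: scalar free_algebra_closed)
  \<comment> \<open>The sum is built up over subsets of the support; membership in the carrier is
    carried along because \<open>add\<close> asks for it.\<close>
  have "(\<Sum>w\<in>A. Poly_Mapping.single w (Poly_Mapping.lookup p w)) \<in> ?F \<and>
        P (\<Sum>w\<in>A. Poly_Mapping.single w (Poly_Mapping.lookup p w))"
    if "finite A" "A \<subseteq> Poly_Mapping.keys p" for A
    using that
  proof (induction A rule: finite_induct)
    case empty
    show ?case by (simp add: zero free_algebra_zero_closed)
  next
    case (insert w A)
    with p have "set (letters w) \<subseteq> S"
      by (simp add: in_free_algebra)
    with insert show ?case
      by (simp add: mono add free_algebra_add_closed)
  qed
  from this[of "Poly_Mapping.keys p"] show ?thesis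
    by (simp add: sum_monomials)
qed

lemma falg_induct [case_names zero add scalar one gen]:
  assumes "P 0" "\<And>p q. P p \<Longrightarrow> P q \<Longrightarrow> P (p + q)" "\<And>c p. P p \<Longrightarrow> P (scalar c * p)"
    "P 1" "\<And>x p. P p \<Longrightarrow> P (gen x * p)"
  shows "P p"
proof -
  have "p \<in> carrier (free_algebra UNIV)"
    by (simp add: in_free_algebra)
  then show ?thesis
    by (induction rule: free_algebra_induct) (use assms in auto)
qed

text \<open>The evaluation map from the universal property of the free algebra.\<close>

definition subst :: "('g \<Rightarrow> 'h falg) \<Rightarrow> 'g falg \<Rightarrow> 'h falg" where
  "subst \<psi> p =
    (\<Sum>w\<in>Poly_Mapping.keys p. scalar (Poly_Mapping.lookup p w) * prod_list (map \<psi> (letters w)))"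

lemma subst_single:
  "subst \<psi> (Poly_Mapping.single w c) = scalar c * prod_list (map \<psi> (letters w))"
  by (simp add: subst_def)

lemma subst_0 [simp]: "subst \<psi> 0 = 0"
  by (simp add: subst_def)

lemma subst_1 [simp]: "subst \<psi> 1 = 1"
  using subst_single[of \<psi> 0 1] by simp

lemma subst_gen [simp]: "subst \<psi> (gen x) = \<psi> x"
  by (simp add: gen_def subst_single)

lemma subst_scalar [simp]: "subst \<psi> (scalar c) = scalar c"
  using subst_single[of \<psi> 0 c, folded scalar_def] by simp

lemma subst_add [simp]: "subst \<psi> (p + q) = subst \<psi> p + subst \<psi> q"
  unfolding subst_def
  by (rule setsum_keys_plus_distrib) (simp_all add: scalar_add distrib_right)

lemma subst_uminus [simp]: "subst \<psi> (- p) = - subst \<psi> p"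
  using subst_add[of \<psi> p "- p"] by (simp add: eq_neg_iff_add_eq_0 add.commute)

lemma subst_diff [simp]: "subst \<psi> (p - q) = subst \<psi> p - subst \<psi> q"
  using subst_add[of \<psi> p "- q"] by simp

text \<open>Both sides are additive in \<open>p\<close>, so \<open>p\<close> may be taken to be a
  monomial as well; there the central scalars move to the front and the two words
  concatenate.\<close>

lemma subst_single_mult:
  fixes \<psi> :: "'g \<Rightarrow> 'h falg"
  shows "subst \<psi> (Poly_Mapping.single w c * p) = subst \<psi> (Poly_Mapping.single w c) * subst \<psi> p"
proof -
  have *: "scalar a * u * (scalar b * v) = scalar (a * b) * (u * v)" for a b and u v :: "'h falg"
    using scalar_commute[of u b] by (simp add: scalar_mult mult.assoc) (simp flip: mult.assoc)
  have "subst \<psi> (Poly_Mapping.single w c * Poly_Mapping.single v d) =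
        subst \<psi> (Poly_Mapping.single w c) * subst \<psi> (Poly_Mapping.single v d)" for v d
    by (simp add: mult_single subst_single *)
  moreover have "subst \<psi> (sum f A) = (\<Sum>a\<in>A. subst \<psi> (f a))"
    for f :: "'g fmon \<Rightarrow> 'g falg" and A
    by (induction A rule: infinite_finite_induct) simp_all
  ultimately have "subst \<psi> (Poly_Mapping.single w c *
       (\<Sum>v\<in>Poly_Mapping.keys p. Poly_Mapping.single v (Poly_Mapping.lookup p v))) =
     subst \<psi> (Poly_Mapping.single w c) *
       subst \<psi> (\<Sum>v\<in>Poly_Mapping.keys p. Poly_Mapping.single v (Poly_Mapping.lookup p v))"
    by (simp add: sum_distrib_left)
  then show ?thesis
    by (simp add: sum_monomials)
qed

text \<open>Scalars and generators are monomials, so induction on the left factor peels them off one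
  by one with \<open>subst_single_mult\<close>.\<close>

lemma subst_mult [simp]: "subst \<psi> (p * q) = subst \<psi> p * subst \<psi> q"
proof (induction p rule: falg_induct)
  case (scalar c p)
  then show ?case
    using subst_single_mult[of \<psi> 0 c] by (simp add: mult.assoc flip: scalar_def)
next
  case (gen x p)
  then show ?case
    using subst_single_mult[of \<psi> "Fmon [x]" 1] by (simp add: mult.assoc flip: gen_def)
qed (simp_all add: distrib_right)

lemma subst_closed:
  assumes "p \<in> carrier (free_algebra S)" "\<And>x. x \<in> S \<Longrightarrow> \<psi> x \<in> carrier (free_algebra T)"
  shows "subst \<psi> p \<in> carrier (free_algebra T)"
  using assms(1)
  by (induction rule: free_algebra_induct)
     (simp_all add: free_algebra_closed free_algebra_zero_closed assms(2))


section \<open>Homomorphisms of presented algebras\<close>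

definition presented_class ::
    "'g set \<Rightarrow> ('g falg \<times> 'g falg) set \<Rightarrow> 'g falg \<Rightarrow> 'g falg set" where
  "presented_class S Rel p = relation_ideal S Rel +>\<^bsub>free_algebra S\<^esub> p"

lemma presented_gen_eq: "presented_gen S Rel x = presented_class S Rel (gen x)"
  by (simp add: presented_gen_def presented_class_def)

locale presentation =
  fixes S :: "'g set" and Rel :: "('g falg \<times> 'g falg) set"
  assumes Rel_closed: "Rel \<subseteq> carrier (free_algebra S) \<times> carrier (free_algebra S)"
begin

abbreviation I where "I \<equiv> relation_ideal S Rel"
abbreviation F where "F \<equiv> free_algebra S"
abbreviation P where "P \<equiv> presented_algebra S Rel"
abbreviation cl where "cl \<equiv> presented_class S Rel"

sublocale I: ideal I F
  by (rule ideal_relation_ideal[OF Rel_closed])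

sublocale P: ring P
  by (rule ring_presented_algebra[OF Rel_closed])

lemma class_eq_image: "cl p = (\<lambda>i. i + p) ` I"
  by (auto simp: presented_class_def a_r_coset_def r_coset_def free_algebra_simps)

lemma ideal_add: "i \<in> I \<Longrightarrow> j \<in> I \<Longrightarrow> i + j \<in> I"
  using additive_subgroup.a_closed[OF I.is_additive_subgroup] by (simp add: free_algebra_simps)

lemma ideal_zero: "0 \<in> I"
  using additive_subgroup.zero_closed[OF I.is_additive_subgroup] by (simp add: free_algebra_simps)

lemma ideal_mult:
  "i \<in> I \<Longrightarrow> p \<in> carrier F \<Longrightarrow> p * i \<in> I" "i \<in> I \<Longrightarrow> p \<in> carrier F \<Longrightarrow> i * p \<in> I"
  using I.I_l_closed I.I_r_closed by (simp_all add: free_algebra_simps)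

lemma ideal_minus: "i \<in> I \<Longrightarrow> - i \<in> I"
  using ideal_mult(1)[of i "-1"] by (simp add: free_algebra_closed)

lemma class_eq_iff: "cl p = cl q \<longleftrightarrow> p - q \<in> I"
proof
  assume "cl p = cl q"
  moreover have "p \<in> cl p"
    using ideal_zero by (force simp: class_eq_image)
  ultimately show "p - q \<in> I"
    by (auto simp: class_eq_image)
next
  have *: "cl p \<subseteq> cl q" if "p - q \<in> I" for p q
  proof
    fix x assume "x \<in> cl p"
    then obtain i where "i \<in> I" "x = i + p"
      by (auto simp: class_eq_image)
    then have "i + (p - q) \<in> I" "x = (i + (p - q)) + q"
      using that by (simp_all add: ideal_add)
    then show "x \<in> cl q"
      unfolding class_eq_image by blast
  qed
  assume "p - q \<in> I"
  with *[of p q] *[of q p] ideal_minus[of "p - q"] show "cl p = cl q"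
    by auto
qed

lemma mem_class: "x \<in> cl p \<longleftrightarrow> cl x = cl p"
proof -
  have "x \<in> cl p \<longleftrightarrow> x - p \<in> I"
    unfolding class_eq_image by (metis (no_types, lifting) add_diff_cancel diff_add_cancel imageE imageI)
  then show ?thesis
    by (simp add: class_eq_iff)
qed

lemma carrier_P: "carrier P = cl ` carrier F"
  by (auto simp: presented_algebra_simps FactRing_simps presented_class_def)

lemma class_closed: "p \<in> carrier F \<Longrightarrow> cl p \<in> carrier P"
  by (simp add: carrier_P)

lemma
  assumes "p \<in> carrier F" "q \<in> carrier F"
  shows class_mult: "cl (p * q) = cl p \<otimes>\<^bsub>P\<^esub> cl q"
    and class_add: "cl (p + q) = cl p \<oplus>\<^bsub>P\<^esub> cl q"
  using ring_hom_mult[OF I.rcos_ring_hom assms] ring_hom_add[OF I.rcos_ring_hom assms]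
  by (simp_all add: presented_class_def presented_algebra_simps free_algebra_simps)

lemma class_one: "cl 1 = \<one>\<^bsub>P\<^esub>"
  using ring_hom_one[OF I.rcos_ring_hom]
  by (simp add: presented_class_def presented_algebra_simps free_algebra_simps)

text \<open>The action on a coset is defined as a union over all its representatives. As the ideal
  absorbs scalars, every representative contributes the same coset.\<close>

lemma class_smult:
  assumes "p \<in> carrier F"
  shows "c \<odot>\<^bsub>P\<^esub> cl p = cl (scalar c * p)"
proof -
  have "cl (scalar c * q) = cl (scalar c * p)" if "q \<in> cl p" for q
  proof -
    have "q - p \<in> I"
      using that by (simp add: mem_class class_eq_iff)
    from ideal_mult(1)[OF this free_algebra_scalar_closed[of c]] show ?thesis
      by (simp add: class_eq_iff algebra_simps)
  qed
  then have "(\<Union>q\<in>cl p. cl (scalar c * q)) = (\<Union>q\<in>cl p. cl (scalar c * p))"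
    by (rule SUP_cong[OF refl])
  moreover have "p \<in> cl p"
    by (simp add: mem_class)
  ultimately show ?thesis
    by (auto simp: presented_algebra_def ring.defs module.defs free_algebra_simps
        simp flip: presented_class_def)
qed

lemma class_scalar_commute:
  assumes "x \<in> carrier P"
  shows "x \<otimes>\<^bsub>P\<^esub> cl (scalar c) = cl (scalar c) \<otimes>\<^bsub>P\<^esub> x"
proof -
  obtain p where "p \<in> carrier F" "x = cl p"
    using assms by (auto simp: carrier_P)
  then show ?thesis
    by (metis class_mult free_algebra_scalar_closed scalar_commute)
qed

lemma class_prod_list:
  "set ps \<subseteq> carrier F \<Longrightarrow> cl (prod_list ps) = alg_prod P (map cl ps)"
  by (induction ps)
     (simp_all add: alg_prod_def class_one class_mult free_algebra_prod_list_closed)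

lemma class_eq_of_rel:
  assumes "(a, b) \<in> Rel"
  shows "cl a = cl b"
proof -
  have "a - b \<in> carrier F" if "(a, b) \<in> Rel" for a b
    using that Rel_closed free_algebra_add_closed[of a S "- b"]
    by (auto intro: free_algebra_minus_closed)
  then have "{a - b |a b. (a, b) \<in> Rel} \<subseteq> I"
    unfolding relation_ideal_def by (intro I.genideal_self) auto
  with assms show ?thesis
    by (auto simp: class_eq_iff)
qed

end

text \<open>The universal property of a presentation: evaluation descends to the quotient once its
  kernel contains the differences that generate the relation ideal.\<close>

lemma presented_algebra_hom_exists:
  assumes "presentation S Rel" "presentation S' Rel'"
    and \<psi>: "\<And>x. x \<in> S \<Longrightarrow> \<psi> x \<in> carrier (free_algebra S')"
    and rels: "\<And>a b. (a, b) \<in> Rel \<Longrightarrow>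
      presented_class S' Rel' (subst \<psi> a) = presented_class S' Rel' (subst \<psi> b)"
  shows "\<exists>h\<in>alg_hom (presented_algebra S Rel) (presented_algebra S' Rel').
    \<forall>x\<in>S. h (presented_gen S Rel x) = presented_class S' Rel' (\<psi> x)"
proof -
  interpret A: presentation S Rel by fact
  interpret B: presentation S' Rel' by fact
  \<comment> \<open>The kernel of evaluation followed by the projection onto the target
    algebra.\<close>
  define K where "K = {p \<in> carrier A.F. subst \<psi> p \<in> B.I}"
  have "ideal K A.F"
  proof (rule idealI[OF ring_free_algebra])
    show "subgroup K (add_monoid A.F)"
    proof (rule group.subgroupI)
      show "group (add_monoid A.F)"
        using A.I.is_abelian_group abelian_group.a_group by blast
      fix p assume p: "p \<in> K"
      \<comment> \<open>The inverse in the structure is identified with the minus of the type by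
        uniqueness of inverses.\<close>
      then have "\<ominus>\<^bsub>A.F\<^esub> p = - p"
        using A.I.minus_equality[of "- p" p]
        by (simp add: K_def free_algebra_closed free_algebra_simps)
      with p show "inv\<^bsub>add_monoid A.F\<^esub> p \<in> K"
        by (simp add: a_inv_def K_def B.ideal_minus free_algebra_closed)
    next
      show "K \<noteq> {}"
        using B.ideal_zero free_algebra_zero_closed by (force simp: K_def)
    qed (auto simp: K_def free_algebra_simps free_algebra_closed B.ideal_add)
  qed (auto simp: K_def free_algebra_simps free_algebra_closed intro: B.ideal_mult subst_closed \<psi>)
  moreover have "{a - b |a b. (a, b) \<in> Rel} \<subseteq> K"
  proof clarify
    fix a b assume ab: "(a, b) \<in> Rel"
    with A.Rel_closed have "a \<in> carrier A.F" "- b \<in> carrier A.F"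
      by (auto intro: free_algebra_closed)
    from free_algebra_add_closed[OF this] rels[OF ab] show "a - b \<in> K"
      by (simp add: K_def B.class_eq_iff)
  qed
  ultimately have "A.I \<subseteq> K"
    unfolding relation_ideal_def by (rule A.I.genideal_minimal)
  then have cong: "B.cl (subst \<psi> p) = B.cl (subst \<psi> q)" if "A.cl p = A.cl q" for p q
    using that by (auto simp: A.class_eq_iff B.class_eq_iff K_def)
  \<comment> \<open>By \<open>cong\<close> the chosen representative does not affect the value on a
    coset.\<close>
  define h where "h C = B.cl (subst \<psi> (SOME p. p \<in> C))" for C
  have h: "h (A.cl p) = B.cl (subst \<psi> p)" for p
  proof -
    have "p \<in> A.cl p"
      by (simp add: A.mem_class)
    then have "(SOME q. q \<in> A.cl p) \<in> A.cl p"
      by (rule someI)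
    then show ?thesis
      unfolding h_def by (intro cong) (simp add: A.mem_class)
  qed
  have sub: "subst \<psi> p \<in> carrier B.F" if "p \<in> carrier A.F" for p
    using that \<psi> by (rule subst_closed)
  have "h \<in> ring_hom A.P B.P"
    by (rule ring_hom_memI)
       (auto simp: A.carrier_P h B.class_closed sub B.class_mult B.class_add B.class_one
         free_algebra_closed
         simp flip: A.class_mult A.class_add A.class_one)
  moreover have "h (c \<odot>\<^bsub>A.P\<^esub> x) = c \<odot>\<^bsub>B.P\<^esub> h x" if "x \<in> carrier A.P" for c x
    using that by (auto simp: A.carrier_P A.class_smult B.class_smult h sub)
  ultimately have "h \<in> alg_hom A.P B.P"
    by (simp add: alg_hom_def)
  then show ?thesis
    by (intro bexI[of _ h]) (simp_all add: h presented_gen_eq)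
qed

text \<open>Uniqueness in the universal property: the elements of the free algebra on whose classes
  \<open>f\<close> and \<open>g\<close> agree are closed under every step of
  \<open>free_algebra_induct\<close>.\<close>

lemma alg_hom_eqI:
  assumes "presentation S Rel" "ring B"
    and f: "f \<in> alg_hom (presented_algebra S Rel) B"
    and g: "g \<in> alg_hom (presented_algebra S Rel) B"
    and gens: "\<And>x. x \<in> S \<Longrightarrow> f (presented_gen S Rel x) = g (presented_gen S Rel x)"
    and x: "x \<in> carrier (presented_algebra S Rel)"
  shows "f x = g x"
proof -
  interpret A: presentation S Rel by fact
  interpret B: ring B by fact
  have hom: "f \<in> ring_hom A.P B" "g \<in> ring_hom A.P B"
    using f g by (simp_all add: alg_hom_def)
  then interpret f: ring_hom_ring A.P B f + g: ring_hom_ring A.P B g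
    by (unfold_locales; simp)+
  obtain p where p: "p \<in> carrier A.F" "x = A.cl p"
    using x by (auto simp: A.carrier_P)
  from p(1) have "f (A.cl p) = g (A.cl p)"
  proof (induction rule: free_algebra_induct)
    case zero
    \<comment> \<open>An additively idempotent element is zero, and homomorphisms preserve
      zero.\<close>
    have "A.cl 0 \<oplus>\<^bsub>A.P\<^esub> A.cl 0 = A.cl 0"
      by (simp add: free_algebra_zero_closed flip: A.class_add)
    then have "A.cl 0 = \<zero>\<^bsub>A.P\<^esub>"
      using A.P.add.l_cancel_one' A.class_closed free_algebra_zero_closed by metis
    then show ?case by simp
  next
    case (scalar c p)
    then have "f (c \<odot>\<^bsub>A.P\<^esub> A.cl p) = g (c \<odot>\<^bsub>A.P\<^esub> A.cl p)"
      using f g by (simp add: alg_hom_def A.class_closed)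
    then show ?case
      using scalar by (simp add: A.class_smult)
  next
    case (gen x p)
    then show ?case
      using gens[of x]
      by (simp add: A.class_mult A.class_closed free_algebra_closed presented_gen_eq)
  qed (simp_all add: A.class_add A.class_closed A.class_one)
  then show ?thesis
    by (simp add: p)
qed


section \<open>Words in Brauer generators\<close>

context Group.monoid
begin

lemma left_commute:
  "c \<otimes> a = a \<otimes> c \<Longrightarrow> a \<in> carrier G \<Longrightarrow> c \<in> carrier G \<Longrightarrow> w \<in> carrier G \<Longrightarrow>
    c \<otimes> (a \<otimes> w) = a \<otimes> (c \<otimes> w)"
  by (simp flip: m_assoc)

lemma commute_mult:
  assumes "a \<otimes> c = c \<otimes> a" "b \<otimes> c = c \<otimes> b" "a \<in> carrier G" "b \<in> carrier G" "c \<in> carrier G"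
  shows "(a \<otimes> b) \<otimes> c = c \<otimes> (a \<otimes> b)"
  using assms by (metis m_assoc)

lemma interchange:
  assumes "c \<otimes> b = b \<otimes> c"
    "a \<in> carrier G" "b \<in> carrier G" "c \<in> carrier G" "d \<in> carrier G"
  shows "(a \<otimes> c) \<otimes> (b \<otimes> d) = (a \<otimes> b) \<otimes> (c \<otimes> d)"
  using assms by (simp add: m_assoc left_commute[of c b d])

text \<open>Separates a word over two parallel bonds into one word per bond; \<open>a\<close> and
  \<open>a'\<close>, \<open>b\<close> belong to the first bond, \<open>c\<close>, \<open>d\<close>
  and \<open>c'\<close> to the second.\<close>

lemma interchange3:
  assumes "c \<otimes> b = b \<otimes> c" "c \<otimes> a' = a' \<otimes> c" "d \<otimes> a' = a' \<otimes> d"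
    and [simp]: "a \<in> carrier G" "b \<in> carrier G" "c \<in> carrier G" "d \<in> carrier G"
      "a' \<in> carrier G" "c' \<in> carrier G"
  shows "(a \<otimes> c) \<otimes> (b \<otimes> d) \<otimes> (a' \<otimes> c') = (a \<otimes> b \<otimes> a') \<otimes> (c \<otimes> d \<otimes> c')"
  using assms(1-3) by (simp add: interchange commute_mult)

text \<open>Serves the double bonds, with \<open>x\<close>, \<open>z\<close> at the ends of the
  lifted path and \<open>y\<close> in its middle. Since \<open>z\<close> commutes with
  \<open>x\<close> only, it stays outside and occurs twice in the result; its square later yields
  the factor \<open>delta\<close>.\<close>

lemma sandwich:
  assumes "x \<otimes> y \<otimes> x = x" "z \<otimes> x = x \<otimes> z"
    and [simp]: "x \<in> carrier G" "y \<in> carrier G" "z \<in> carrier G"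
  shows "(x \<otimes> z) \<otimes> y \<otimes> (x \<otimes> z) = (x \<otimes> z) \<otimes> z"
proof -
  have "(x \<otimes> z) \<otimes> y \<otimes> (x \<otimes> z) = z \<otimes> (x \<otimes> y \<otimes> x) \<otimes> z"
    using assms(2) by (simp add: m_assoc left_commute)
  then show ?thesis
    using assms(1,2) by simp
qed

end

text \<open>
  Two singly bonded nodes, with Brauer generators \<open>a\<close>, \<open>x\<close> and \<open>b\<close>, \<open>y\<close>. The defining relations
  are closed under reversal of words, but not visibly so: this is the content of \<open>x_b_a\<close>.
\<close>

locale brauer_bond = Group.monoid G for G (structure) +
  fixes a x b y
  assumes closed [simp]: "a \<in> carrier G" "x \<in> carrier G" "b \<in> carrier G" "y \<in> carrier G"
    and a_a: "a \<otimes> a = \<one>" and b_b: "b \<otimes> b = \<one>"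
    and x_a: "x \<otimes> a = x" and y_b: "y \<otimes> b = y"
    and braid: "a \<otimes> b \<otimes> a = b \<otimes> a \<otimes> b"
    and b_a_y: "b \<otimes> a \<otimes> y = x \<otimes> y"
    and a_b_x: "a \<otimes> b \<otimes> x = y \<otimes> x"
    and a_y_a: "a \<otimes> y \<otimes> a = b \<otimes> x \<otimes> b"
begin

text \<open>The axioms are symmetric in the two nodes, so all consequences hold with the nodes
  exchanged.\<close>

lemma swap: "brauer_bond G b y a x"
  by unfold_locales (simp_all add: a_a b_b x_a y_b braid b_a_y a_b_x a_y_a)

lemma x_b_a: "x \<otimes> b \<otimes> a = x \<otimes> y"
proof -
  have "x \<otimes> b \<otimes> a = (b \<otimes> b) \<otimes> x \<otimes> b \<otimes> a"
    by (simp add: b_b)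
  \<comment> \<open>The inserted \<open>b\<close> completes a block to which the conjugation
    relation \<open>a_y_a\<close> applies.\<close>
  also have "\<dots> = b \<otimes> (b \<otimes> x \<otimes> b) \<otimes> a"
    by (simp add: m_assoc)
  also have "\<dots> = b \<otimes> a \<otimes> y \<otimes> (a \<otimes> a)"
    by (simp add: m_assoc flip: a_y_a)
  finally show ?thesis
    by (simp add: a_a b_a_y)
qed

lemma a_y_x: "a \<otimes> y \<otimes> x = b \<otimes> x"
proof -
  have "a \<otimes> y \<otimes> x = a \<otimes> (a \<otimes> b \<otimes> x)"
    by (simp add: a_b_x m_assoc)
  also have "\<dots> = (a \<otimes> a) \<otimes> (b \<otimes> x)"
    by (simp add: m_assoc)
  finally show ?thesis
    by (simp add: a_a)
qed

lemma x_y_a: "x \<otimes> y \<otimes> a = x \<otimes> b"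
proof -
  have "x \<otimes> y \<otimes> a = x \<otimes> b \<otimes> (a \<otimes> a)"
    by (simp add: m_assoc flip: x_b_a)
  then show ?thesis
    by (simp add: a_a)
qed

lemma x_y_x: "x \<otimes> y \<otimes> x = x"
proof -
  have "x \<otimes> y \<otimes> x = b \<otimes> (a \<otimes> y \<otimes> x)"
    by (simp add: m_assoc flip: b_a_y)
  also have "\<dots> = (b \<otimes> b) \<otimes> x"
    by (simp add: a_y_x m_assoc)
  finally show ?thesis
    by (simp add: b_b)
qed

text \<open>By \<open>a_y_x\<close> the letter \<open>b\<close> before \<open>x\<close> may be
  traded for \<open>a\<close>, \<open>y\<close>; then \<open>x\<close> absorbs \<open>a\<close> and
  the Temperley-Lieb relation remains.\<close>

lemma x_b_x: "x \<otimes> b \<otimes> x = x"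
proof -
  have "x \<otimes> b \<otimes> x = x \<otimes> (a \<otimes> y \<otimes> x)"
    by (simp add: a_y_x m_assoc)
  also have "\<dots> = (x \<otimes> a) \<otimes> y \<otimes> x"
    by (simp add: m_assoc)
  finally show ?thesis
    by (simp add: x_a x_y_x)
qed

end

text \<open>Dictionary for a double bond i \<Rightarrow> j: the letters \<open>b\<close>,
  \<open>y\<close> are the images of \<open>r\<^sub>i\<close>, \<open>e\<^sub>i\<close>, and the
  products of \<open>a\<close>, \<open>c\<close> and of \<open>x\<close>, \<open>z\<close> are those
  of \<open>r\<^sub>j\<close>, \<open>e\<^sub>j\<close>. Most \<open>fold_\<close> lemmas are then
  one double bond relation each.\<close>

locale brauer_path = ab: brauer_bond G a x b y + cb: brauer_bond G c z b y
  for G (structure) and a x b y c z +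
  assumes commute: "c \<otimes> a = a \<otimes> c" "c \<otimes> x = x \<otimes> c" "z \<otimes> a = a \<otimes> z" "z \<otimes> x = x \<otimes> z"
begin

interpretation bc: brauer_bond G b y c z by (rule cb.swap)

text \<open>Normalises words by moving letters of the end \<open>c\<close>, \<open>z\<close> to the
  right past letters of the end \<open>a\<close>, \<open>x\<close>.\<close>

lemmas rearrange = ab.m_assoc commute commute[THEN ab.left_commute]

text \<open>The braid relation of length four comes from those of length three, applied in turn to
  the blocks c b c, b a b, a b a and b c b.\<close>

lemma fold_braid: "(a \<otimes> c) \<otimes> b \<otimes> (a \<otimes> c) \<otimes> b = b \<otimes> (a \<otimes> c) \<otimes> b \<otimes> (a \<otimes> c)"
proof -
  have "(a \<otimes> c) \<otimes> b \<otimes> (a \<otimes> c) \<otimes> b = a \<otimes> (c \<otimes> b \<otimes> c) \<otimes> (a \<otimes> b)"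
    by (simp add: rearrange)
  also have "\<dots> = a \<otimes> b \<otimes> c \<otimes> (b \<otimes> a \<otimes> b)"
    by (simp add: cb.braid ab.m_assoc)
  also have "\<dots> = (a \<otimes> b \<otimes> a) \<otimes> (c \<otimes> b \<otimes> a)"
    by (simp add: rearrange flip: ab.braid)
  also have "\<dots> = b \<otimes> a \<otimes> (b \<otimes> c \<otimes> b) \<otimes> a"
    by (simp add: ab.braid ab.m_assoc)
  also have "\<dots> = b \<otimes> (a \<otimes> c) \<otimes> b \<otimes> (a \<otimes> c)"
    by (simp add: rearrange flip: cb.braid)
  finally show ?thesis .
qed

text \<open>The bond of \<open>c\<close> and \<open>b\<close> absorbs \<open>c\<close> and turns
  \<open>b\<close> into \<open>y\<close>; the bond of \<open>a\<close> and \<open>b\<close> then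
  absorbs \<open>a\<close> and turns \<open>y\<close> back into \<open>b\<close>.\<close>

lemma fold_rre: "(a \<otimes> c) \<otimes> b \<otimes> (x \<otimes> z) = b \<otimes> (x \<otimes> z)"
proof -
  have "(a \<otimes> c) \<otimes> b \<otimes> (x \<otimes> z) = a \<otimes> (c \<otimes> b \<otimes> z) \<otimes> x"
    by (simp add: rearrange)
  also have "\<dots> = (a \<otimes> y \<otimes> x) \<otimes> z"
    by (simp only: cb.a_b_x) (simp add: rearrange)
  finally show ?thesis
    by (simp add: ab.a_y_x ab.m_assoc)
qed

text \<open>Conjugation by \<open>a\<close> replaces \<open>y\<close> by b x b, after which only the
  bond of \<open>c\<close> and \<open>b\<close> has to be used.\<close>

lemma fold_rere: "(a \<otimes> c) \<otimes> y \<otimes> (a \<otimes> c) \<otimes> y = y \<otimes> (x \<otimes> z) \<otimes> y"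
proof -
  have "(a \<otimes> c) \<otimes> y \<otimes> (a \<otimes> c) \<otimes> y = c \<otimes> (a \<otimes> y \<otimes> a) \<otimes> (c \<otimes> y)"
    by (simp add: rearrange)
  also have "\<dots> = c \<otimes> b \<otimes> x \<otimes> (b \<otimes> c \<otimes> y)"
    by (simp only: ab.a_y_a) (simp add: ab.m_assoc)
  also have "\<dots> = (c \<otimes> b \<otimes> z) \<otimes> (x \<otimes> y)"
    by (simp only: cb.b_a_y) (simp add: rearrange)
  also have "\<dots> = y \<otimes> (x \<otimes> z) \<otimes> y"
    by (simp only: cb.a_b_x) (simp add: rearrange)
  finally show ?thesis .
qed

text \<open>In the picture on four strands, the word in \<open>a\<close>, \<open>b\<close>,
  \<open>c\<close> is the transposition of the two outer strands, while \<open>y\<close> joins the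
  inner ones. Algebraically both sides reduce to the word y a z y.\<close>

lemma fold_rrre:
  "((a \<otimes> c) \<otimes> b \<otimes> (a \<otimes> c)) \<otimes> y = y \<otimes> ((a \<otimes> c) \<otimes> b \<otimes> (a \<otimes> c))"
proof -
  have "(a \<otimes> c) \<otimes> b \<otimes> (a \<otimes> c) = c \<otimes> (a \<otimes> b \<otimes> a) \<otimes> c"
    by (simp add: rearrange)
  then have *: "(a \<otimes> c) \<otimes> b \<otimes> (a \<otimes> c) = c \<otimes> (b \<otimes> a \<otimes> b) \<otimes> c"
    by (simp only: ab.braid)
  have "(c \<otimes> (b \<otimes> a \<otimes> b) \<otimes> c) \<otimes> y = c \<otimes> b \<otimes> a \<otimes> (b \<otimes> c \<otimes> y)"
    by (simp add: ab.m_assoc)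
  also have "\<dots> = (c \<otimes> b \<otimes> z) \<otimes> (a \<otimes> y)"
    by (simp only: cb.b_a_y) (simp add: rearrange)
  also have "\<dots> = y \<otimes> a \<otimes> (z \<otimes> y)"
    by (simp only: cb.a_b_x) (simp add: rearrange)
  \<comment> \<open>From the middle word y a z y on, the reduction runs backwards and builds up the
    other side.\<close>
  also have "\<dots> = y \<otimes> a \<otimes> (z \<otimes> b \<otimes> c)"
    by (simp only: cb.x_b_a)
  also have "\<dots> = (y \<otimes> z) \<otimes> (a \<otimes> b \<otimes> c)"
    by (simp add: rearrange)
  also have "\<dots> = (y \<otimes> c \<otimes> b) \<otimes> (a \<otimes> b \<otimes> c)"
    by (simp only: bc.x_b_a)
  also have "\<dots> = y \<otimes> (c \<otimes> (b \<otimes> a \<otimes> b) \<otimes> c)"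
    by (simp add: ab.m_assoc)
  finally show ?thesis
    by (simp only: *)
qed

text \<open>The mirror image of \<open>fold_rre\<close>, with the reversed relations
  \<open>x_b_a\<close> and \<open>x_y_a\<close>.\<close>

lemma fold_err: "(x \<otimes> z) \<otimes> b \<otimes> (a \<otimes> c) = (x \<otimes> z) \<otimes> b"
proof -
  have "(x \<otimes> z) \<otimes> b \<otimes> (a \<otimes> c) = z \<otimes> (x \<otimes> b \<otimes> a) \<otimes> c"
    by (simp add: rearrange)
  also have "\<dots> = x \<otimes> (z \<otimes> y \<otimes> c)"
    by (simp only: ab.x_b_a) (simp add: rearrange)
  finally show ?thesis
    by (simp add: cb.x_y_a ab.m_assoc)
qed

lemma fold_eer: "(x \<otimes> z) \<otimes> y \<otimes> (a \<otimes> c) = (x \<otimes> z) \<otimes> y"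
proof -
  have "(x \<otimes> z) \<otimes> y \<otimes> (a \<otimes> c) = z \<otimes> (x \<otimes> y \<otimes> a) \<otimes> c"
    by (simp add: rearrange)
  also have "\<dots> = x \<otimes> (z \<otimes> b \<otimes> c)"
    by (simp only: ab.x_y_a) (simp add: rearrange)
  finally show ?thesis
    by (simp add: cb.x_b_a ab.m_assoc)
qed

text \<open>A monoid has no scalars, so the expected factor \<open>delta\<close> appears here as a
  second \<open>z\<close>.\<close>

lemma fold_ere: "(x \<otimes> z) \<otimes> b \<otimes> (x \<otimes> z) = (x \<otimes> z) \<otimes> z"
  by (rule ab.sandwich) (simp_all add: ab.x_b_x commute)

end


section \<open>Foldings\<close>

text \<open>Collects what the three families have in common, so that relations are checked without
  regard to the type. On nodes of \<open>M\<close>, \<open>kappa\<close> is the size of the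
  fibre.\<close>

locale folding =
  fixes M Q :: diagram and \<sigma> :: "nat \<Rightarrow> nat list"
  assumes kappa: "j \<in> nodes Q \<Longrightarrow> kappa Q j = 1"
    and fiber: "i \<in> nodes M \<Longrightarrow>
      (\<exists>a\<in>nodes Q. \<sigma> i = [a] \<and> kappa M i = 1) \<or>
      (\<exists>a c. \<sigma> i = [a, c] \<and> kappa M i = 2 \<and> non_adjacent Q a c)"
    and fiber_non_adjacent: "non_adjacent M i j \<Longrightarrow> a \<in> set (\<sigma> i) \<Longrightarrow> b \<in> set (\<sigma> j) \<Longrightarrow>
      non_adjacent Q a b"
    and fiber_simple: "simply_bonded M i j \<Longrightarrow>
      (\<exists>a b. \<sigma> i = [a] \<and> \<sigma> j = [b] \<and> simply_bonded Q a b) \<or>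
      (\<exists>a b c d. \<sigma> i = [a, c] \<and> \<sigma> j = [b, d] \<and> simply_bonded Q a b \<and> simply_bonded Q c d \<and>
        non_adjacent Q a c \<and> non_adjacent Q a d \<and> non_adjacent Q b c \<and> non_adjacent Q b d)"
    and fiber_double: "doubly_bonded M i j \<Longrightarrow>
      \<exists>a b c. \<sigma> i = [b] \<and> \<sigma> j = [a, c] \<and> simply_bonded Q a b \<and> simply_bonded Q c b \<and>
        non_adjacent Q a c"

begin

lemma fiber_closed: "i \<in> nodes M \<Longrightarrow> a \<in> set (\<sigma> i) \<Longrightarrow> a \<in> nodes Q"
  using fiber[of i] by (auto dest: bonded_nodes)

end

section \<open>The three families of foldings\<close>

lemmas diagram_defs =
  dynkin_A_def dynkin_B_def dynkin_C_def dynkin_D_def dynkin_E_def dynkin_F4_def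
  simply_bonded_def doubly_bonded_def non_adjacent_def

lemma folding_C:
  assumes "1 \<le> n"
  shows "folding (dynkin_C n) (dynkin_A (2 * n - 1)) (\<lambda>i. if i = 0 then [n] else [n - i, n + i])"
    (is "folding ?M ?Q ?\<sigma>")
proof
  fix i assume "i \<in> nodes ?M"
  then show "(\<exists>a\<in>nodes ?Q. ?\<sigma> i = [a] \<and> kappa ?M i = 1) \<or>
      (\<exists>a c. ?\<sigma> i = [a, c] \<and> kappa ?M i = 2 \<and> non_adjacent ?Q a c)"
    using assms by (auto simp: diagram_defs)
next
  fix i j a b assume "non_adjacent ?M i j" "a \<in> set (?\<sigma> i)" "b \<in> set (?\<sigma> j)"
  then show "non_adjacent ?Q a b"
    using assms by (auto simp: diagram_defs split: if_splits)
next
  fix i j assume "simply_bonded ?M i j"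
  then show "(\<exists>a b. ?\<sigma> i = [a] \<and> ?\<sigma> j = [b] \<and> simply_bonded ?Q a b) \<or>
      (\<exists>a b c d. ?\<sigma> i = [a, c] \<and> ?\<sigma> j = [b, d] \<and> simply_bonded ?Q a b \<and> simply_bonded ?Q c d \<and>
        non_adjacent ?Q a c \<and> non_adjacent ?Q a d \<and> non_adjacent ?Q b c \<and> non_adjacent ?Q b d)"
    using assms by (auto simp: diagram_defs)
next
  fix i j assume "doubly_bonded ?M i j"
  then show "\<exists>a b c. ?\<sigma> i = [b] \<and> ?\<sigma> j = [a, c] \<and> simply_bonded ?Q a b \<and>
      simply_bonded ?Q c b \<and> non_adjacent ?Q a c"
    using assms by (auto simp: diagram_defs)
qed (simp add: diagram_defs)

lemma folding_B: "2 \<le> n \<Longrightarrow> folding (dynkin_B n) (dynkin_D (n + 1))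
    (\<lambda>i. if i = 0 then [1, 2] else [i + 2])"
  by unfold_locales (auto simp: diagram_defs split: if_splits)

text \<open>Explicit finite sets turn the conditions of the folding of \<open>dynkin_F4\<close> into
  a finite check.\<close>

lemma dynkin_E6_eq: "dynkin_E 6 =
    \<lparr>nodes = {1, 2, 3, 4, 5, 6}, simple_bonds = {(1, 3), (3, 4), (2, 4), (4, 5), (5, 6)},
     double_bonds = {}, kappa = (\<lambda>i. 1)\<rparr>"
proof -
  have "{(i, i + 1) |i. 4 \<le> i \<and> i + 1 \<le> 6} = {(4, 5), (5, 6 :: nat)}"
    by (auto simp: le_Suc_eq numeral_eq_Suc)
  moreover have "{1..6} = {1, 2, 3, 4, 5, 6 :: nat}"
    by auto
  ultimately show ?thesis
    by (auto simp: dynkin_E_def)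
qed

lemma folding_F4:
  "folding dynkin_F4 (dynkin_E 6)
    (\<lambda>i. if i = 1 then [1, 6] else if i = 2 then [3, 5] else if i = 3 then [4] else [2])"
    (is "folding ?M ?Q ?\<sigma>")
proof
  fix i assume "i \<in> nodes ?M"
  then have "i \<in> {1, 2, 3, 4}"
    by (simp add: dynkin_F4_def)
  then show "(\<exists>a\<in>nodes ?Q. ?\<sigma> i = [a] \<and> kappa ?M i = 1) \<or>
      (\<exists>a c. ?\<sigma> i = [a, c] \<and> kappa ?M i = 2 \<and> non_adjacent ?Q a c)"
    unfolding dynkin_E6_eq
    by (elim insertE emptyE) (simp_all add: diagram_defs)
next
  fix i j a b assume *: "non_adjacent ?M i j" "a \<in> set (?\<sigma> i)" "b \<in> set (?\<sigma> j)"
  then have "(i, j) \<in> {(1, 3), (3, 1), (1, 4), (4, 1), (2, 4), (4, 2)}"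
    by (simp add: diagram_defs) presburger
  then show "non_adjacent ?Q a b"
    using *(2,3) unfolding dynkin_E6_eq
    by (elim insertE emptyE) (auto simp: diagram_defs)
next
  fix i j assume "simply_bonded ?M i j"
  then have "(i, j) \<in> {(1, 2), (2, 1), (3, 4), (4, 3)}"
    by (simp add: diagram_defs) presburger
  then show "(\<exists>a b. ?\<sigma> i = [a] \<and> ?\<sigma> j = [b] \<and> simply_bonded ?Q a b) \<or>
      (\<exists>a b c d. ?\<sigma> i = [a, c] \<and> ?\<sigma> j = [b, d] \<and> simply_bonded ?Q a b \<and> simply_bonded ?Q c d \<and>
        non_adjacent ?Q a c \<and> non_adjacent ?Q a d \<and> non_adjacent ?Q b c \<and> non_adjacent ?Q b d)"
    unfolding dynkin_E6_eq
    by (elim insertE emptyE) (simp_all add: diagram_defs)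
next
  fix i j assume "doubly_bonded ?M i j"
  then show "\<exists>a b c. ?\<sigma> i = [b] \<and> ?\<sigma> j = [a, c] \<and> simply_bonded ?Q a b \<and>
      simply_bonded ?Q c b \<and> non_adjacent ?Q a c"
    unfolding dynkin_E6_eq
    by (simp add: diagram_defs)
qed (simp add: diagram_defs)

lemma folding_if_diagram_folding: "diagram_folding M Q \<sigma> \<Longrightarrow> folding M Q \<sigma>"
  by (erule diagram_folding.cases) (simp_all only: folding_C folding_B folding_F4)


section \<open>Temperley-Lieb relations of the folded generators\<close>

lemma non_adjacent_sym: "non_adjacent M i j \<Longrightarrow> non_adjacent M j i"
  by (auto simp: non_adjacent_def simply_bonded_def)

lemma simply_bonded_sym: "simply_bonded M i j \<Longrightarrow> simply_bonded M j i"
  by (auto simp: simply_bonded_def)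

lemma presentation_dtl: "presentation (nodes M) (dtl_rels M)"
  by (rule presentation.intro[OF dtl_rels_closed])

lemma presentation_br: "presentation (br_gens M) (br_rels M)"
  by (rule presentation.intro[OF br_rels_closed])

text \<open>Settles all relations between non-adjacent nodes, whose fibres commute letter by letter.
  One induction moves a single letter through a product, a second one treats the whole
  product.\<close>

lemma (in presentation) class_prod_list_commute:
  assumes "set ps \<subseteq> carrier F" "set qs \<subseteq> carrier F"
    and "\<forall>p\<in>set ps. \<forall>q\<in>set qs. cl p \<otimes>\<^bsub>P\<^esub> cl q = cl q \<otimes>\<^bsub>P\<^esub> cl p"
  shows "cl (prod_list ps * prod_list qs) = cl (prod_list qs * prod_list ps)"
proof -
  note [simp] = free_algebra_closed free_algebra_prod_list_closed class_mult class_closed class_one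
  have *: "cl p \<otimes>\<^bsub>P\<^esub> cl (prod_list qs) = cl (prod_list qs) \<otimes>\<^bsub>P\<^esub> cl p"
    if "p \<in> carrier F" "set qs \<subseteq> carrier F"
      "\<forall>q\<in>set qs. cl p \<otimes>\<^bsub>P\<^esub> cl q = cl q \<otimes>\<^bsub>P\<^esub> cl p" for p qs
    using that(2,3)
  proof (induction qs)
    case (Cons q qs)
    then have "cl q \<otimes>\<^bsub>P\<^esub> cl p = cl p \<otimes>\<^bsub>P\<^esub> cl q"
      and "cl (prod_list qs) \<otimes>\<^bsub>P\<^esub> cl p = cl p \<otimes>\<^bsub>P\<^esub> cl (prod_list qs)"
      by simp_all
    from P.commute_mult[OF this] show ?case
      using Cons.prems(1) that(1) by simp
  qed (simp add: that(1))
  have "cl (prod_list ps) \<otimes>\<^bsub>P\<^esub> cl (prod_list qs) = cl (prod_list qs) \<otimes>\<^bsub>P\<^esub> cl (prod_list ps)"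
    using assms(1,3)
  proof (induction ps)
    case (Cons p ps)
    have "cl p \<otimes>\<^bsub>P\<^esub> cl (prod_list qs) = cl (prod_list qs) \<otimes>\<^bsub>P\<^esub> cl p"
      by (rule *) (use Cons.prems assms(2) in auto)
    moreover have "cl (prod_list ps) \<otimes>\<^bsub>P\<^esub> cl (prod_list qs) =
        cl (prod_list qs) \<otimes>\<^bsub>P\<^esub> cl (prod_list ps)"
      by (rule Cons.IH) (use Cons.prems in auto)
    ultimately have "(cl p \<otimes>\<^bsub>P\<^esub> cl (prod_list ps)) \<otimes>\<^bsub>P\<^esub> cl (prod_list qs) =
        cl (prod_list qs) \<otimes>\<^bsub>P\<^esub> (cl p \<otimes>\<^bsub>P\<^esub> cl (prod_list ps))"
      by (rule P.commute_mult) (use Cons.prems(1) assms(2) in auto)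
    then show ?case
      using Cons.prems(1) assms(2) by simp
  qed (simp add: assms(2))
  with assms(1,2) show ?thesis
    by simp
qed

text \<open>
  Covers both \<open>DTL Q\<close> with its own generators and \<open>Br Q\<close> with the generators \<open>e\<^sub>j\<close>, so that the folded
  Temperley-Lieb relations are checked only once.
\<close>

locale tl_family = presentation S Rel
  for S :: "'g set" and Rel +
  fixes Q :: diagram and \<epsilon> :: "nat \<Rightarrow> 'g falg"
  assumes \<epsilon>_closed: "j \<in> nodes Q \<Longrightarrow> \<epsilon> j \<in> carrier F"
    and \<epsilon>_rels: "(a, b) \<in> dtl_rels Q \<Longrightarrow> cl (subst \<epsilon> a) = cl (subst \<epsilon> b)"
begin

lemma
  shows \<epsilon>_square: "j \<in> nodes Q \<Longrightarrow> cl (\<epsilon> j) \<otimes>\<^bsub>P\<^esub> cl (\<epsilon> j) = cl (scalar (delta ^ kappa Q j)) \<otimes>\<^bsub>P\<^esub> cl (\<epsilon> j)"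
    and \<epsilon>_commute: "non_adjacent Q i j \<Longrightarrow> cl (\<epsilon> i) \<otimes>\<^bsub>P\<^esub> cl (\<epsilon> j) = cl (\<epsilon> j) \<otimes>\<^bsub>P\<^esub> cl (\<epsilon> i)"
    and \<epsilon>_bond: "simply_bonded Q i j \<Longrightarrow> cl (\<epsilon> i) \<otimes>\<^bsub>P\<^esub> cl (\<epsilon> j) \<otimes>\<^bsub>P\<^esub> cl (\<epsilon> i) = cl (\<epsilon> i)"
  using dtl_rels.intros(1)[of j Q, THEN \<epsilon>_rels] dtl_rels.intros(2)[of Q i j, THEN \<epsilon>_rels]
    dtl_rels.intros(3)[of Q i j, THEN \<epsilon>_rels]
  by (auto simp: \<epsilon>_closed free_algebra_closed dest: bonded_nodes simp flip: class_mult)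

text \<open>The square relation at the end of a longer word, with its central scalar pulled to the
  front.\<close>

lemma mult_square:
  assumes "j \<in> nodes Q" "x \<in> carrier P"
  shows "x \<otimes>\<^bsub>P\<^esub> cl (\<epsilon> j) \<otimes>\<^bsub>P\<^esub> cl (\<epsilon> j) = cl (scalar (delta ^ kappa Q j)) \<otimes>\<^bsub>P\<^esub> (x \<otimes>\<^bsub>P\<^esub> cl (\<epsilon> j))"
proof -
  note [simp] = assms class_closed \<epsilon>_closed free_algebra_scalar_closed
  have "x \<otimes>\<^bsub>P\<^esub> cl (\<epsilon> j) \<otimes>\<^bsub>P\<^esub> cl (\<epsilon> j) = (x \<otimes>\<^bsub>P\<^esub> cl (scalar (delta ^ kappa Q j))) \<otimes>\<^bsub>P\<^esub> cl (\<epsilon> j)"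
    by (simp add: P.m_assoc \<epsilon>_square)
  also have "\<dots> = (cl (scalar (delta ^ kappa Q j)) \<otimes>\<^bsub>P\<^esub> x) \<otimes>\<^bsub>P\<^esub> cl (\<epsilon> j)"
    by (simp only: class_scalar_commute[OF assms(2)])
  finally show ?thesis
    by (simp add: P.m_assoc)
qed

text \<open>Pairs of commuting nodes are separated by the interchange lemmas, which leaves relations
  of \<open>Q\<close> on each factor.\<close>

lemma fold_dtl_rels:
  assumes "folding M Q \<sigma>" "(a, b) \<in> dtl_rels M"
  shows "cl (subst (\<lambda>i. prod_list (map \<epsilon> (\<sigma> i))) a) = cl (subst (\<lambda>i. prod_list (map \<epsilon> (\<sigma> i))) b)"
proof -
  interpret folding M Q \<sigma> by fact
  note [simp] = free_algebra_closed \<epsilon>_closed class_mult class_closed class_one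
  let ?D = "cl (scalar delta)"
  have square: "cl (\<epsilon> j) \<otimes>\<^bsub>P\<^esub> cl (\<epsilon> j) = ?D \<otimes>\<^bsub>P\<^esub> cl (\<epsilon> j)" if "j \<in> nodes Q" for j
    using \<epsilon>_square[OF that] kappa[OF that] by simp
  from assms(2) show ?thesis
  proof cases
    case (1 i)
    from fiber[OF 1(3)] show ?thesis
    proof (elim disjE exE bexE conjE)
      fix a assume "\<sigma> i = [a]" "kappa M i = 1" "a \<in> nodes Q"
      then show ?thesis
        by (simp add: 1 square)
    next
      fix a c assume *: "\<sigma> i = [a, c]" "kappa M i = 2" "non_adjacent Q a c"
      then have [simp]: "a \<in> nodes Q" "c \<in> nodes Q"
        by (auto dest: bonded_nodes)
      \<comment> \<open>Each of the two nodes contributes one \<open>delta\<close>, in agreement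
        with \<open>kappa M i = 2\<close>.\<close>
      from \<epsilon>_commute[OF non_adjacent_sym[OF *(3)]]
      have "cl (\<epsilon> a) \<otimes>\<^bsub>P\<^esub> cl (\<epsilon> c) \<otimes>\<^bsub>P\<^esub> (cl (\<epsilon> a) \<otimes>\<^bsub>P\<^esub> cl (\<epsilon> c)) =
          (?D \<otimes>\<^bsub>P\<^esub> cl (\<epsilon> a)) \<otimes>\<^bsub>P\<^esub> (?D \<otimes>\<^bsub>P\<^esub> cl (\<epsilon> c))"
        by (subst P.interchange) (simp_all add: square)
      also have "\<dots> = (?D \<otimes>\<^bsub>P\<^esub> ?D) \<otimes>\<^bsub>P\<^esub> (cl (\<epsilon> a) \<otimes>\<^bsub>P\<^esub> cl (\<epsilon> c))"
        by (rule P.interchange) (simp_all add: class_scalar_commute)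
      finally show ?thesis
        using * by (simp add: 1 power2_eq_square scalar_mult)
    qed
  next
    case (2 i j)
    have "cl (prod_list (map \<epsilon> (\<sigma> i)) * prod_list (map \<epsilon> (\<sigma> j))) =
        cl (prod_list (map \<epsilon> (\<sigma> j)) * prod_list (map \<epsilon> (\<sigma> i)))"
    proof (rule class_prod_list_commute)
      show "\<forall>p\<in>set (map \<epsilon> (\<sigma> i)). \<forall>q\<in>set (map \<epsilon> (\<sigma> j)). cl p \<otimes>\<^bsub>P\<^esub> cl q = cl q \<otimes>\<^bsub>P\<^esub> cl p"
        using \<epsilon>_commute[OF fiber_non_adjacent[OF 2(3)]] unfolding set_map by blast
    qed (use fiber_closed bonded_nodes(3)[OF 2(3)] \<epsilon>_closed in auto)
    then show ?thesis
      by (simp add: 2)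
  next
    case (3 i j)
    from fiber_simple[OF 3(3)] show ?thesis
    proof (elim disjE exE conjE)
      fix a b assume "\<sigma> i = [a]" "\<sigma> j = [b]" "simply_bonded Q a b"
      then show ?thesis
        using bonded_nodes(1)[of Q a b] by (simp add: 3 \<epsilon>_bond)
    next
      fix a b c d
      assume *: "\<sigma> i = [a, c]" "\<sigma> j = [b, d]" "simply_bonded Q a b" "simply_bonded Q c d"
        "non_adjacent Q a c" "non_adjacent Q a d" "non_adjacent Q b c" "non_adjacent Q b d"
      then have "a \<in> nodes Q" "b \<in> nodes Q" "c \<in> nodes Q" "d \<in> nodes Q"
        by (auto dest: bonded_nodes)
      then show ?thesis
        using *(1-2) by (simp add: 3 P.interchange3 \<epsilon>_bond \<epsilon>_commute * non_adjacent_sym)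
    qed
  next
    case (4 i j)
    then obtain a b c where *: "\<sigma> i = [b]" "\<sigma> j = [a, c]" "simply_bonded Q a b"
        "simply_bonded Q c b" "non_adjacent Q a c"
      using fiber_double by blast
    then have "a \<in> nodes Q" "b \<in> nodes Q" "c \<in> nodes Q"
      by (auto dest: bonded_nodes)
    \<comment> \<open>\<open>sandwich\<close> leaves the square of the generator at
      \<open>c\<close>, and \<open>mult_square\<close> extracts \<open>delta\<close> from
      it.\<close>
    then show ?thesis
      using *(1,2) by (simp add: 4 kappa mult_square P.sandwich \<epsilon>_bond \<epsilon>_commute * non_adjacent_sym)
  qed
qed

end


lemma subst_gen_id: "subst gen p = p"
  by (induction p rule: falg_induct) simp_all

lemma tl_family_dtl: "tl_family (nodes M) (dtl_rels M) M gen"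
proof -
  interpret presentation "nodes M" "dtl_rels M"
    by (rule presentation_dtl)
  show ?thesis
    by unfold_locales (simp_all add: subst_gen_id class_eq_of_rel free_algebra_closed)
qed

section \<open>Brauer relations of the folded generators\<close>

locale brauer_algebra =
  fixes Q :: diagram
begin

sublocale presentation "br_gens Q" "br_rels Q"
  by (rule presentation_br)

lemma generator_closed:
  "j \<in> nodes Q \<Longrightarrow> r j \<in> carrier F" "j \<in> nodes Q \<Longrightarrow> e j \<in> carrier F"
  by (simp_all add: free_algebra_closed br_gens_def)

lemmas class_simps = free_algebra_closed generator_closed class_mult class_closed class_one

lemma class_generators:
  assumes "j \<in> nodes Q"
  shows "cl (r j) \<otimes>\<^bsub>P\<^esub> cl (r j) = \<one>\<^bsub>P\<^esub>"
    and "cl (r j) \<otimes>\<^bsub>P\<^esub> cl (e j) = cl (e j)"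
    and "cl (e j) \<otimes>\<^bsub>P\<^esub> cl (r j) = cl (e j)"
  using br_rels.intros(1-3)[OF assms, THEN class_eq_of_rel] assms
  by (simp_all add: class_simps)

lemma class_commute:
  assumes "non_adjacent Q i j"
  shows "cl (r i) \<otimes>\<^bsub>P\<^esub> cl (r j) = cl (r j) \<otimes>\<^bsub>P\<^esub> cl (r i)"
    and "cl (e i) \<otimes>\<^bsub>P\<^esub> cl (r j) = cl (r j) \<otimes>\<^bsub>P\<^esub> cl (e i)"
    and "cl (r i) \<otimes>\<^bsub>P\<^esub> cl (e j) = cl (e j) \<otimes>\<^bsub>P\<^esub> cl (r i)"
    and "cl (e i) \<otimes>\<^bsub>P\<^esub> cl (e j) = cl (e j) \<otimes>\<^bsub>P\<^esub> cl (e i)"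
  using br_rels.intros(5-7)[OF assms, THEN class_eq_of_rel] bonded_nodes(3)[OF assms]
    br_rels.intros(6)[OF non_adjacent_sym[OF assms], THEN class_eq_of_rel]
  by (simp_all add: class_simps)

lemma bond:
  assumes "simply_bonded Q i j"
  shows "brauer_bond P (cl (r i)) (cl (e i)) (cl (r j)) (cl (e j))"
proof -
  have [simp]: "i \<in> nodes Q" "j \<in> nodes Q"
    using bonded_nodes(1)[OF assms] by simp_all
  \<comment> \<open>The relation for \<open>b_a_y\<close> is taken in both orders of the bond, as it
    also provides \<open>a_b_x\<close>.\<close>
  note rels = br_rels.intros(8-10)[OF assms, THEN class_eq_of_rel]
    br_rels.intros(9)[OF simply_bonded_sym[OF assms], THEN class_eq_of_rel]
  show ?thesis
    by unfold_locales (use rels in \<open>simp_all add: class_simps class_generators\<close>)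
qed

text \<open>Gives the canonical homomorphism and makes \<open>fold_dtl_rels\<close> available in
  \<open>Br Q\<close>. The single bond relation is the derived identity \<open>x_y_x\<close>; the
  others are in the presentation.\<close>

sublocale tl_family "br_gens Q" "br_rels Q" Q e
proof unfold_locales
  fix a b assume "(a, b) \<in> dtl_rels Q"
  then show "cl (subst e a) = cl (subst e b)"
  proof cases
    case (3 i j)
    then show ?thesis
      using brauer_bond.x_y_x[OF bond[OF 3(3)]] bonded_nodes(1)[OF 3(3)]
      by (simp add: class_simps)
  qed (simp_all add: class_eq_of_rel br_rels.intros)
qed (simp add: generator_closed)

lemma path:
  assumes "simply_bonded Q a b" "simply_bonded Q c b" "non_adjacent Q a c"
  shows "brauer_path P (cl (r a)) (cl (e a)) (cl (r b)) (cl (e b)) (cl (r c)) (cl (e c))"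
  using assms non_adjacent_sym[OF assms(3)]
  by (intro brauer_path.intro bond brauer_path_axioms.intro class_commute)

lemma fold_br_rels:
  fixes \<sigma>
  defines "\<psi> \<equiv> case_brauer_gen (\<lambda>i. prod_list (map r (\<sigma> i))) (\<lambda>i. prod_list (map e (\<sigma> i)))"
  assumes fold: "folding M Q \<sigma>" and ab: "(a, b) \<in> br_rels M"
  shows "cl (subst \<psi> a) = cl (subst \<psi> b)"
proof -
  interpret folding M Q \<sigma> by fact
  note [simp] = class_simps
  have [simp]: "\<psi> (RGen i) = prod_list (map r (\<sigma> i))" "\<psi> (EGen i) = prod_list (map e (\<sigma> i))" for i
    by (simp_all add: \<psi>_def)
  \<comment> \<open>The square and double bond relations in the \<open>e\<^sub>i\<close> alone are
    inherited from the Temperley-Lieb check.\<close>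
  note dtl = dtl_rels.intros[THEN fold_dtl_rels[OF fold]]
  \<comment> \<open>This and the next two facts are elimination rules for the shape of the fibres.
    Non-adjacency is oriented as the premises of \<open>interchange\<close> and
    \<open>interchange3\<close> require.\<close>
  have node: R
    if "i \<in> nodes M"
      and single: "\<And>j. \<sigma> i = [j] \<Longrightarrow> j \<in> nodes Q \<Longrightarrow> R"
      and pair: "\<And>j k. \<sigma> i = [j, k] \<Longrightarrow> j \<in> nodes Q \<Longrightarrow> k \<in> nodes Q \<Longrightarrow>
        non_adjacent Q k j \<Longrightarrow> R" for i R
    using fiber[OF that(1)] single pair by (meson bonded_nodes(3) non_adjacent_sym)
  have simple: R
    if "simply_bonded M i j"
      and single: "\<And>a b. \<sigma> i = [a] \<Longrightarrow> \<sigma> j = [b] \<Longrightarrow> a \<in> nodes Q \<Longrightarrow> b \<in> nodes Q \<Longrightarrow>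
        brauer_bond P (cl (r a)) (cl (e a)) (cl (r b)) (cl (e b)) \<Longrightarrow> R"
      and pair: "\<And>a b c d. \<sigma> i = [a, c] \<Longrightarrow> \<sigma> j = [b, d] \<Longrightarrow>
        a \<in> nodes Q \<Longrightarrow> b \<in> nodes Q \<Longrightarrow> c \<in> nodes Q \<Longrightarrow> d \<in> nodes Q \<Longrightarrow>
        brauer_bond P (cl (r a)) (cl (e a)) (cl (r b)) (cl (e b)) \<Longrightarrow>
        brauer_bond P (cl (r c)) (cl (e c)) (cl (r d)) (cl (e d)) \<Longrightarrow>
        non_adjacent Q c a \<Longrightarrow> non_adjacent Q d a \<Longrightarrow>
        non_adjacent Q c b \<Longrightarrow> non_adjacent Q d b \<Longrightarrow> R" for i j R
    using fiber_simple[OF that(1)]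
  proof (elim disjE exE conjE)
    fix a b assume "\<sigma> i = [a]" "\<sigma> j = [b]" "simply_bonded Q a b"
    then show R
      using single bonded_nodes(1)[of Q a b] bond by simp
  next
    fix a b c d
    assume *: "\<sigma> i = [a, c]" "\<sigma> j = [b, d]" "simply_bonded Q a b" "simply_bonded Q c d"
      "non_adjacent Q a c" "non_adjacent Q a d" "non_adjacent Q b c" "non_adjacent Q b d"
    then show R
      using bonded_nodes(1)[of Q a b] bonded_nodes(1)[of Q c d]
      by (intro pair[OF *(1,2)] bond) (simp_all add: non_adjacent_sym)
  qed
  have double: R
    if ij: "doubly_bonded M i j"
      and that: "\<And>a b c. \<sigma> i = [b] \<Longrightarrow> \<sigma> j = [a, c] \<Longrightarrow>
        a \<in> nodes Q \<Longrightarrow> b \<in> nodes Q \<Longrightarrow> c \<in> nodes Q \<Longrightarrow> non_adjacent Q a c \<Longrightarrow>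
        brauer_path P (cl (r a)) (cl (e a)) (cl (r b)) (cl (e b)) (cl (r c)) (cl (e c)) \<Longrightarrow> R"
    for i j R
  proof -
    obtain a b c where *: "\<sigma> i = [b]" "\<sigma> j = [a, c]" "simply_bonded Q a b" "simply_bonded Q c b"
      "non_adjacent Q a c"
      using fiber_double[OF ij] by blast
    then show R
      using bonded_nodes(1)[of Q a b] bonded_nodes(1)[of Q c b]
      by (intro that[OF *(1,2)] path) simp_all
  qed
  have commute: "cl (prod_list (map f (\<sigma> i)) * prod_list (map g (\<sigma> j))) =
      cl (prod_list (map g (\<sigma> j)) * prod_list (map f (\<sigma> i)))"
    if "non_adjacent M i j" "f \<in> {r, e}" "g \<in> {r, e}" for f g i j
  proof (rule class_prod_list_commute)
    have "cl (f a) \<otimes>\<^bsub>P\<^esub> cl (g b) = cl (g b) \<otimes>\<^bsub>P\<^esub> cl (f a)"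
      if "a \<in> set (\<sigma> i)" "b \<in> set (\<sigma> j)" for a b
      using class_commute[OF fiber_non_adjacent[OF \<open>non_adjacent M i j\<close> that]]
        \<open>f \<in> {r, e}\<close> \<open>g \<in> {r, e}\<close> by (elim insertE emptyE) simp_all
    then show "\<forall>p\<in>set (map f (\<sigma> i)). \<forall>q\<in>set (map g (\<sigma> j)). cl p \<otimes>\<^bsub>P\<^esub> cl q = cl q \<otimes>\<^bsub>P\<^esub> cl p"
      unfolding set_map by blast
  qed (use that(2,3) fiber_closed bonded_nodes(3)[OF that(1)] generator_closed in auto)
  from ab show ?thesis
  proof cases
    case (1 i)
    from 1(3) show ?thesis
      by (rule node) (simp_all add: 1(1,2) P.interchange class_commute class_generators)
  next
    case (2 i)
    from 2(3) show ?thesis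
      by (rule node) (simp_all add: 2(1,2) P.interchange class_commute class_generators)
  next
    case (3 i)
    from 3(3) show ?thesis
      by (rule node) (simp_all add: 3(1,2) P.interchange[OF class_commute(2)] class_generators)
  next
    case (4 i)
    then show ?thesis
      using dtl(1)[of i] by simp
  next
    case (5 i j)
    then show ?thesis
      using commute[of i j r r] by simp
  next
    case (6 i j)
    then show ?thesis
      using commute[of i j e r] by simp
  next
    case (7 i j)
    then show ?thesis
      using commute[of i j e e] by simp
  next
    case (8 i j)
    from 8(3) show ?thesis
    proof (rule simple)
      fix a b assume "\<sigma> i = [a]" "\<sigma> j = [b]" "a \<in> nodes Q" "b \<in> nodes Q"
        and bond: "brauer_bond P (cl (r a)) (cl (e a)) (cl (r b)) (cl (e b))"
      then show ?thesis
        by (simp add: 8(1,2) bond[THEN brauer_bond.braid])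
    next
      fix a b c d
      assume "\<sigma> i = [a, c]" "\<sigma> j = [b, d]"
        "a \<in> nodes Q" "b \<in> nodes Q" "c \<in> nodes Q" "d \<in> nodes Q"
        and bonds: "brauer_bond P (cl (r a)) (cl (e a)) (cl (r b)) (cl (e b))"
        "brauer_bond P (cl (r c)) (cl (e c)) (cl (r d)) (cl (e d))"
        and "non_adjacent Q c a" "non_adjacent Q d a" "non_adjacent Q c b" "non_adjacent Q d b"
      then show ?thesis
        by (simp add: 8(1,2) P.interchange3 class_commute bonds[THEN brauer_bond.braid])
    qed
  next
    case (9 i j)
    from 9(3) show ?thesis
    proof (rule simple)
      fix a b assume "\<sigma> i = [a]" "\<sigma> j = [b]" "a \<in> nodes Q" "b \<in> nodes Q"
        and bond: "brauer_bond P (cl (r a)) (cl (e a)) (cl (r b)) (cl (e b))"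
      then show ?thesis
        by (simp add: 9(1,2) bond[THEN brauer_bond.b_a_y])
    next
      fix a b c d
      assume "\<sigma> i = [a, c]" "\<sigma> j = [b, d]"
        "a \<in> nodes Q" "b \<in> nodes Q" "c \<in> nodes Q" "d \<in> nodes Q"
        and bonds: "brauer_bond P (cl (r a)) (cl (e a)) (cl (r b)) (cl (e b))"
        "brauer_bond P (cl (r c)) (cl (e c)) (cl (r d)) (cl (e d))"
        and "non_adjacent Q c a" "non_adjacent Q d a" "non_adjacent Q c b" "non_adjacent Q d b"
      then show ?thesis
        \<comment> \<open>Specialised to letters \<open>e\<close>, \<open>interchange\<close>
          regroups the right-hand side; the left-hand side is the work of
          \<open>interchange3\<close>.\<close>
        by (simp add: 9(1,2) P.interchange[OF class_commute(4)] P.interchange3 class_commute bonds[THEN brauer_bond.b_a_y])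
    qed
  next
    case (10 i j)
    from 10(3) show ?thesis
    proof (rule simple)
      fix a b assume "\<sigma> i = [a]" "\<sigma> j = [b]" "a \<in> nodes Q" "b \<in> nodes Q"
        and bond: "brauer_bond P (cl (r a)) (cl (e a)) (cl (r b)) (cl (e b))"
      then show ?thesis
        by (simp add: 10(1,2) bond[THEN brauer_bond.a_y_a])
    next
      fix a b c d
      assume "\<sigma> i = [a, c]" "\<sigma> j = [b, d]"
        "a \<in> nodes Q" "b \<in> nodes Q" "c \<in> nodes Q" "d \<in> nodes Q"
        and bonds: "brauer_bond P (cl (r a)) (cl (e a)) (cl (r b)) (cl (e b))"
        "brauer_bond P (cl (r c)) (cl (e c)) (cl (r d)) (cl (e d))"
        and "non_adjacent Q c a" "non_adjacent Q d a" "non_adjacent Q c b" "non_adjacent Q d b"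
      then show ?thesis
        by (simp add: 10(1,2) P.interchange3 class_commute bonds[THEN brauer_bond.a_y_a])
    qed
  next
    case (11 i j)
    from 11(3) show ?thesis
      by (rule double) (simp add: 11(1,2) brauer_path.fold_braid)
  next
    case (12 i j)
    from 12(3) show ?thesis
      by (rule double) (simp add: 12(1,2) brauer_path.fold_rre)
  next
    case (13 i j)
    from 13(3) show ?thesis
      by (rule double) (simp add: 13(1,2) brauer_path.fold_rere)
  next
    case (14 i j)
    from 14(3) show ?thesis
      by (rule double) (simp add: 14(1,2) brauer_path.fold_rrre)
  next
    case (15 i j)
    from 15(3) show ?thesis
    proof (rule double)
      fix a b c
      assume *: "\<sigma> i = [b]" "\<sigma> j = [a, c]" "a \<in> nodes Q" "b \<in> nodes Q" "c \<in> nodes Q"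
        and "non_adjacent Q a c"
        and path: "brauer_path P (cl (r a)) (cl (e a)) (cl (r b)) (cl (e b)) (cl (r c)) (cl (e c))"
      \<comment> \<open>Turns the doubled letter left by \<open>fold_ere\<close> into the scalar
        \<open>delta\<close>.\<close>
      have "cl (e a) \<otimes>\<^bsub>P\<^esub> cl (e c) \<otimes>\<^bsub>P\<^esub> cl (e c) =
          cl (scalar delta) \<otimes>\<^bsub>P\<^esub> (cl (e a) \<otimes>\<^bsub>P\<^esub> cl (e c))"
        using * by (simp add: mult_square kappa)
      then show ?thesis
        using * brauer_path.fold_ere[OF path] by (simp add: 15(1,2))
    qed
  next
    case (16 i j)
    then show ?thesis
      using dtl(4)[of i j] by simp
  next
    case (17 i j)
    from 17(3) show ?thesis
      by (rule double) (simp add: 17(1,2) brauer_path.fold_err)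
  next
    case (18 i j)
    from 18(3) show ?thesis
      by (rule double) (simp add: 18(1,2) brauer_path.fold_eer)
  qed
qed

end


section \<open>The homomorphisms and the commuting square\<close>

lemma canonical_hom_exists: "\<exists>\<phi>. canonical_hom M \<phi>"
proof -
  interpret brauer_algebra M .
  obtain h where "h \<in> alg_hom (DTL M) P"
      "\<forall>i\<in>nodes M. h (presented_gen (nodes M) (dtl_rels M) i) = cl (e i)"
    using presented_algebra_hom_exists[OF presentation_dtl presentation_br \<epsilon>_closed \<epsilon>_rels]
    unfolding DTL_def by blast
  then show ?thesis
    unfolding canonical_hom_def dtl_e_def br_e_def Br_def presented_gen_eq by blast
qed

context folding
begin

lemma tl_folding_hom_exists: "\<exists>g. tl_folding_hom M Q \<sigma> g"
proof -
  interpret tl_family "nodes Q" "dtl_rels Q" Q gen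
    by (rule tl_family_dtl)
  have fibers: "set (map gen (\<sigma> i)) \<subseteq> carrier F" if "i \<in> nodes M" for i
    using fiber_closed[OF that] \<epsilon>_closed by auto
  obtain g where g: "g \<in> alg_hom (DTL M) (TL Q)"
      "\<forall>i\<in>nodes M. g (dtl_e M i) = cl (prod_list (map gen (\<sigma> i)))"
    using presented_algebra_hom_exists[OF presentation_dtl presentation_dtl
        free_algebra_prod_list_closed[OF fibers] fold_dtl_rels[OF folding_axioms]]
    unfolding DTL_def dtl_e_def by blast
  have "cl (prod_list (map gen (\<sigma> i))) = alg_prod (TL Q) (map (dtl_e Q) (\<sigma> i))"
    if "i \<in> nodes M" for i
    using class_prod_list[OF fibers[OF that]]
    by (simp add: DTL_def dtl_e_def[abs_def] presented_gen_eq comp_def)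
  with g have "tl_folding_hom M Q \<sigma> g"
    by (simp add: tl_folding_hom_def)
  then show ?thesis
    by blast
qed

lemma br_folding_hom_exists: "\<exists>f. br_folding_hom M Q \<sigma> f"
proof -
  interpret brauer_algebra Q .
  define \<psi> where
    "\<psi> = case_brauer_gen (\<lambda>i. prod_list (map r (\<sigma> i))) (\<lambda>i. prod_list (map e (\<sigma> i)))"
  have fibers: "set (map r (\<sigma> i)) \<subseteq> carrier F" "set (map e (\<sigma> i)) \<subseteq> carrier F"
    if "i \<in> nodes M" for i
    using fiber_closed[OF that] generator_closed by auto
  have closed: "\<psi> x \<in> carrier F" if "x \<in> br_gens M" for x
    using that free_algebra_prod_list_closed[OF fibers(1)]
      free_algebra_prod_list_closed[OF fibers(2)]
    by (auto simp: br_gens_def \<psi>_def)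
  obtain f where f: "f \<in> alg_hom (Br M) (Br Q)"
      "\<forall>x\<in>br_gens M. f (presented_gen (br_gens M) (br_rels M) x) = cl (\<psi> x)"
    using presented_algebra_hom_exists[OF presentation_br presentation_br closed
        fold_br_rels[OF folding_axioms, folded \<psi>_def]]
    unfolding Br_def by blast
  have "f (br_r M i) = alg_prod (Br Q) (map (br_r Q) (\<sigma> i))"
    "f (br_e M i) = alg_prod (Br Q) (map (br_e Q) (\<sigma> i))" if "i \<in> nodes M" for i
    using f(2)[rule_format, of "RGen i"] f(2)[rule_format, of "EGen i"] that
      class_prod_list[OF fibers(1)[OF that]] class_prod_list[OF fibers(2)[OF that]]
    by (simp_all add: Br_def br_r_def[abs_def] br_e_def[abs_def] presented_gen_eq comp_def
        br_gens_def \<psi>_def)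
  with f have "br_folding_hom M Q \<sigma> f"
    by (simp add: br_folding_hom_def)
  then show ?thesis
    by blast
qed

end

lemma alg_hom_comp:
  assumes "f \<in> alg_hom A B" "g \<in> alg_hom B C"
  shows "g \<circ> f \<in> alg_hom A C"
  using assms ring_hom_trans[of f A B g C] ring_hom_closed[of f A B]
  by (simp add: alg_hom_def)

text \<open>Membership in the carrier is part of the induction, since multiplicativity of
  \<open>f\<close> holds only there.\<close>

lemma ring_hom_alg_prod:
  assumes "f \<in> ring_hom A B" "ring A" "set xs \<subseteq> carrier A"
  shows "alg_prod A xs \<in> carrier A \<and> f (alg_prod A xs) = alg_prod B (map f xs)"
proof -
  interpret ring A by fact
  show ?thesis
    using assms(3)
    by (induction xs) (simp_all add: alg_prod_def ring_hom_one[OF assms(1)] ring_hom_mult[OF assms(1)])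
qed

text \<open>By \<open>alg_hom_eqI\<close> it suffices to compare the composites at
  \<open>e\<^sub>i\<close>, where both give the product of the \<open>e\<^sub>j\<close> over the
  fibre.\<close>

lemma folding_square_commutes:
  assumes "folding M Q \<sigma>" "canonical_hom M \<phi>" "br_folding_hom M Q \<sigma> f"
    "tl_folding_hom M Q \<sigma> g" "canonical_hom Q \<iota>" "x \<in> carrier (DTL M)"
  shows "f (\<phi> x) = \<iota> (g x)"
proof -
  interpret folding M Q \<sigma> by fact
  have homs: "f \<circ> \<phi> \<in> alg_hom (DTL M) (Br Q)" "\<iota> \<circ> g \<in> alg_hom (DTL M) (Br Q)"
    using assms(2-5)
    by (auto simp: canonical_hom_def br_folding_hom_def tl_folding_hom_def intro: alg_hom_comp)
  have "f (\<phi> (dtl_e M i)) = \<iota> (g (dtl_e M i))" if i: "i \<in> nodes M" for i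
  proof -
    interpret tl_family "nodes Q" "dtl_rels Q" Q gen
      by (rule tl_family_dtl)
    have "set (map (dtl_e Q) (\<sigma> i)) \<subseteq> carrier (DTL Q)"
      using fiber_closed[OF i] class_closed \<epsilon>_closed
      by (auto simp: DTL_def dtl_e_def presented_gen_eq)
    moreover have "\<iota> \<in> ring_hom (DTL Q) (Br Q)"
      using assms(5) by (simp add: canonical_hom_def alg_hom_def)
    ultimately have "\<iota> (alg_prod (DTL Q) (map (dtl_e Q) (\<sigma> i))) =
        alg_prod (Br Q) (map (\<lambda>j. \<iota> (dtl_e Q j)) (\<sigma> i))"
      using ring_hom_alg_prod[OF _ ring_DTL] by (fastforce simp: comp_def)
    also have "map (\<lambda>j. \<iota> (dtl_e Q j)) (\<sigma> i) = map (br_e Q) (\<sigma> i)"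
      using assms(5) fiber_closed[OF i] by (simp add: canonical_hom_def)
    finally show ?thesis
      using assms(2-4) i by (simp add: canonical_hom_def br_folding_hom_def tl_folding_hom_def)
  qed
  then have "(f \<circ> \<phi>) x = (\<iota> \<circ> g) x"
    using alg_hom_eqI[OF presentation_dtl ring_Br homs[unfolded DTL_def] _ assms(6)[unfolded DTL_def]]
    by (simp add: dtl_e_def)
  then show ?thesis
    by simp
qed

text \<open>The square is stated for any four maps with the prescribed values on generators; the
  existence claims ensure that this is not vacuous.\<close>

theorem theorem4p5:
  "(\<forall>M. dynkin M \<longrightarrow> (\<exists>\<phi>. canonical_hom M \<phi>)) \<and>
   (\<forall>M Q \<sigma>. diagram_folding M Q \<sigma> \<longrightarrow>
      (\<exists>f. br_folding_hom M Q \<sigma> f) \<and>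
      (\<exists>g. tl_folding_hom M Q \<sigma> g) \<and>
      (\<exists>\<iota>. canonical_hom Q \<iota>) \<and>
      (\<forall>\<phi> f g \<iota>.
         canonical_hom M \<phi> \<longrightarrow> br_folding_hom M Q \<sigma> f \<longrightarrow>
         tl_folding_hom M Q \<sigma> g \<longrightarrow> canonical_hom Q \<iota> \<longrightarrow>
         (\<forall>x\<in>carrier (DTL M). f (\<phi> x) = \<iota> (g x))))"
  using canonical_hom_exists folding.br_folding_hom_exists folding.tl_folding_hom_exists
    folding_if_diagram_folding folding_square_commutes by (metis (no_types, lifting))

end
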